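(* Let $X,Y$ be complex Banach spaces and let $\alpha,\beta\in(0,1]$. Let $\phi:\overline{\mathbb{D}}\to\overline{\mathbb{D}}$ be a nonconstant continuous map that is analytic on $\mathbb{D}$, let $\Psi:\overline{\mathbb{D}}\to L(X,Y)$ be continuous and analytic on $\mathbb{D}$, and put $\varphi=\phi|_{\mathbb{D}}:\mathbb{D}\to\mathbb{D}$, $\psi=\Psi|_{\mathbb{D}}$. Let $W_{\Psi,\phi}:\operatorname{lip}_A(\overline{\mathbb{D}},X,\alpha)\to\operatorname{lip}_A(\overline{\mathbb{D}},Y,\beta)$ be a bounded weighted composition operator. Consider the condition $$(\ast)\qquad \lim_{|z|\to1^-}\frac{(1-|z|^2)^{1-\beta}}{(1-|\varphi(z)|^2)^{1-\alpha}}\,|\varphi'(z)|\,\|\psi_z\|=0 .$$ (i) If $W_{\Psi,\phi}$ is compact, then $\Psi\in\operatorname{Lip}_A(\overline{\mathbb{D}},K(X,Y),\beta)$ and $(\ast)$ holds. (ii) If $\Psi\in\operatorname{lip}_A(\overline{\mathbb{D}},K(X,Y),\beta)$ and $(\ast)$ holds, then $W_{\Psi,\phi}$ is compact.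
   Context: $\mathbb{D}$ is the open unit disk of $\mathbb{C}$ and $\overline{\mathbb{D}}$ its closure. $L(X,Y)$ and $K(X,Y)$ are the Banach spaces of bounded, respectively compact, linear operators $X\to Y$ with the operator norm. For a Banach space $X$, $A(\overline{\mathbb{D}},X)$ is the space of continuous functions $\overline{\mathbb{D}}\to X$ that are analytic on $\mathbb{D}$. For $\alpha\in(0,1]$, $\operatorname{Lip}_A(\overline{\mathbb{D}},X,\alpha)$ is the space of all $f\in A(\overline{\mathbb{D}},X)$ with $p_\alpha(f)=\sup_{z\ne w\in\overline{\mathbb{D}}}\|f(z)-f(w)\|/|z-w|^\alpha<\infty$, a Banach space under $\|f\|_\alpha=\sup_{z\in\overline{\mathbb{D}}}\|f(z)\|+p_\alpha(f)$, and $\operatorname{lip}_A(\overline{\mathbb{D}},X,\alpha)$ is its closed subspace of those $f$ with $\lim_{|z-w|\to0}\|f(z)-f(w)\|/|z-w|^\alpha=0$. The same definitions apply with $X$ replaced by $Y$ or $K(X,Y)$ and $\alpha$ by $\beta$. Write $\Psi_z=\Psi(z)$, $\psi_z=\psi(z)$. The weighted composition operator is $W_{\Psi,\phi}(f)(z)=\Psi_z(f(\phi(z)))$, $z\in\overline{\mathbb{D}}$, for $f:\overline{\mathbb{D}}\to X$.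
   Formalization: In (i), condition (∗) is concluded only for α<1: at α=1 the space lip_A consists of constants, and φ(z)=z, Ψ=id, X=Y=ℂ, β=1 gives a compact operator for which the expression in (∗) is identically 1. *)

theory Defs
  imports "HOL-Analysis.Analysis"
begin

text \<open>
  HOL-Analysis has only real normed spaces. A complex Banach space is a type of sort
  \<open>{complex_normed_vector, banach}\<close>: its norm and metric are those of the underlying real space.
\<close>

class complex_normed_vector = real_normed_vector +
  fixes scaleC :: "complex \<Rightarrow> 'a \<Rightarrow> 'a" (infixr "*\<^sub>C" 75)
  assumes scaleC_add_right: "a *\<^sub>C (x + y) = a *\<^sub>C x + a *\<^sub>C y"
    and scaleC_add_left: "(a + b) *\<^sub>C x = a *\<^sub>C x + b *\<^sub>C x"
    and scaleC_scaleC: "a *\<^sub>C b *\<^sub>C x = (a * b) *\<^sub>C x"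
    and scaleC_one: "1 *\<^sub>C x = x"
    and scaleC_of_real: "complex_of_real r *\<^sub>C x = r *\<^sub>R x"
    and norm_scaleC: "norm (a *\<^sub>C x) = norm a * norm x"

instantiation complex :: complex_normed_vector
begin

definition scaleC_complex :: "complex \<Rightarrow> complex \<Rightarrow> complex" where
  "scaleC_complex a x = a * x"

instance
  by standard (simp_all add: scaleC_complex_def algebra_simps norm_mult scaleR_conv_of_real)

end

lemma bounded_linear_scaleC_right:
  "bounded_linear (\<lambda>x::'a::complex_normed_vector. a *\<^sub>C x)"
proof (rule bounded_linear_intro[where K = "norm a"])
  fix r and x :: 'a
  show "a *\<^sub>C (r *\<^sub>R x) = r *\<^sub>R (a *\<^sub>C x)"
    by (metis scaleC_of_real scaleC_scaleC mult.commute)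
qed (simp_all add: scaleC_add_right norm_scaleC mult.commute)

lemma bounded_linear_scaleC_left:
  "bounded_linear (\<lambda>a. a *\<^sub>C (x::'a::complex_normed_vector))"
proof (rule bounded_linear_intro[where K = "norm x"])
  fix r and a
  show "(r *\<^sub>R a) *\<^sub>C x = r *\<^sub>R (a *\<^sub>C x)"
    by (metis scaleC_of_real scaleC_scaleC scaleR_conv_of_real)
qed (simp_all add: scaleC_add_left norm_scaleC)

instantiation blinfun :: (real_normed_vector, complex_normed_vector) complex_normed_vector
begin

definition scaleC_blinfun ::
    "complex \<Rightarrow> ('a \<Rightarrow>\<^sub>L 'b) \<Rightarrow> ('a \<Rightarrow>\<^sub>L 'b)" where
  "scaleC_blinfun a T = Blinfun (\<lambda>x. a *\<^sub>C blinfun_apply T x)"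

lemma scaleC_blinfun_apply: "blinfun_apply (a *\<^sub>C T) x = a *\<^sub>C blinfun_apply T x"
  unfolding scaleC_blinfun_def
  by (subst bounded_linear_Blinfun_apply)
     (auto intro: bounded_linear_compose[OF bounded_linear_scaleC_right blinfun.bounded_linear_right])

instance
proof
  fix a b :: complex and r :: real and S T :: "'a \<Rightarrow>\<^sub>L 'b"
  show "a *\<^sub>C (S + T) = a *\<^sub>C S + a *\<^sub>C T"
    by (rule blinfun_eqI) (simp add: scaleC_blinfun_apply blinfun.add_left scaleC_add_right)
  show "(a + b) *\<^sub>C T = a *\<^sub>C T + b *\<^sub>C T"
    by (rule blinfun_eqI) (simp add: scaleC_blinfun_apply blinfun.add_left scaleC_add_left)
  show "a *\<^sub>C b *\<^sub>C T = (a * b) *\<^sub>C T"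
    by (rule blinfun_eqI) (simp add: scaleC_blinfun_apply scaleC_scaleC)
  show "1 *\<^sub>C T = T"
    by (rule blinfun_eqI) (simp add: scaleC_blinfun_apply scaleC_one)
  show "complex_of_real r *\<^sub>C T = r *\<^sub>R T"
    by (rule blinfun_eqI) (simp add: scaleC_blinfun_apply scaleC_of_real blinfun.scaleR_left)
  have le: "norm (c *\<^sub>C U) \<le> norm c * norm U" for c and U :: "'a \<Rightarrow>\<^sub>L 'b"
  proof (rule norm_blinfun_bound)
    fix x
    show "norm (blinfun_apply (c *\<^sub>C U) x) \<le> norm c * norm U * norm x"
      using mult_left_mono[OF norm_blinfun[of U x] norm_ge_zero[of c]]
      by (simp add: scaleC_blinfun_apply norm_scaleC mult.assoc)
  qed simp
  show "norm (a *\<^sub>C T) = norm a * norm T"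
  proof (cases "a = 0")
    case True
    then show ?thesis using le[of a T] by simp
  next
    case False
    have "T = inverse a *\<^sub>C a *\<^sub>C T"
      by (rule blinfun_eqI) (simp add: scaleC_blinfun_apply scaleC_scaleC scaleC_one False)
    then have "norm T \<le> norm (inverse a) * norm (a *\<^sub>C T)"
      using le[of "inverse a" "a *\<^sub>C T"] by simp
    then have "norm a * norm T \<le> norm a * (norm (inverse a) * norm (a *\<^sub>C T))"
      by (rule mult_left_mono) simp
    also have "\<dots> = norm (a *\<^sub>C T)"
      using False by (simp add: norm_inverse)
    finally have "norm a * norm T \<le> norm (a *\<^sub>C T)" .
    with le[of a T] show ?thesis by simp
  qed
qed

end

text \<open>
  \<open>L(X,Y)\<close> and \<open>K(X,Y)\<close> as complex subspaces of the real Banach space \<open>'a \<Rightarrow>\<^sub>L 'b\<close>, whose norm is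
  the operator norm.
\<close>

definition bounded_ops ::
    "('a::complex_normed_vector \<Rightarrow>\<^sub>L 'b::complex_normed_vector) set" where
  "bounded_ops = {T. \<forall>a x. blinfun_apply T (a *\<^sub>C x) = a *\<^sub>C blinfun_apply T x}"

definition compact_ops ::
    "('a::complex_normed_vector \<Rightarrow>\<^sub>L 'b::complex_normed_vector) set" where
  "compact_ops = {T \<in> bounded_ops. compact (closure (blinfun_apply T ` cball 0 1))}"

text \<open>
  \<open>disk_algebra S\<close> is the space of continuous functions from the closed disk to \<open>S\<close> that are analytic
  (norm complex differentiable) on the open disk.
  A function on the closed disk is a total function that is zero off the closed disk. The parameter
  \<open>S\<close> is the target space, a subspace of the type \<open>'a\<close>; it is \<open>UNIV\<close> when the target is all of \<open>'a\<close>.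
\<close>

definition disk_algebra ::
    "'a::complex_normed_vector set \<Rightarrow> (complex \<Rightarrow> 'a) set" where
  "disk_algebra S =
     {f. f ` cball 0 1 \<subseteq> S \<and> (\<forall>z. z \<notin> cball 0 1 \<longrightarrow> f z = 0) \<and>
         continuous_on (cball 0 1) f \<and>
         (\<forall>z\<in>ball 0 1. \<exists>d\<in>S. (f has_derivative (\<lambda>h. h *\<^sub>C d)) (at z))}"

definition Lip_quotients :: "real \<Rightarrow> (complex \<Rightarrow> 'a::real_normed_vector) \<Rightarrow> real set" where
  "Lip_quotients \<alpha> f =
     {norm (f z - f w) / norm (z - w) powr \<alpha> | z w. z \<in> cball 0 1 \<and> w \<in> cball 0 1 \<and> z \<noteq> w}"

definition Lip_norm :: "real \<Rightarrow> (complex \<Rightarrow> 'a::real_normed_vector) \<Rightarrow> real" where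
  "Lip_norm \<alpha> f = (SUP z\<in>cball 0 1. norm (f z)) + Sup (Lip_quotients \<alpha> f)"

definition Lip_A ::
    "'a::complex_normed_vector set \<Rightarrow> real \<Rightarrow> (complex \<Rightarrow> 'a) set" where
  "Lip_A S \<alpha> = {f \<in> disk_algebra S. bdd_above (Lip_quotients \<alpha> f)}"

definition lip_A ::
    "'a::complex_normed_vector set \<Rightarrow> real \<Rightarrow> (complex \<Rightarrow> 'a) set" where
  "lip_A S \<alpha> = {f \<in> Lip_A S \<alpha>.
     \<forall>\<epsilon>>0. \<exists>\<delta>>0. \<forall>z\<in>cball 0 1. \<forall>w\<in>cball 0 1. 0 < norm (z - w) \<and> norm (z - w) < \<delta> \<longrightarrow>
       norm (f z - f w) / norm (z - w) powr \<alpha> < \<epsilon>}"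

text \<open>
  The norm metric and topology of \<open>lip_A UNIV \<alpha>\<close>. The locale \<open>Metric_space\<close> wants a distance that
  is nonnegative off the carrier too, hence the dummy value there.
\<close>

definition Lip_dist ::
    "real \<Rightarrow> (complex \<Rightarrow> 'a::complex_normed_vector) \<Rightarrow> (complex \<Rightarrow> 'a) \<Rightarrow> real" where
  "Lip_dist \<alpha> f g =
     (if f \<in> lip_A UNIV \<alpha> \<and> g \<in> lip_A UNIV \<alpha> then Lip_norm \<alpha> (\<lambda>z. f z - g z) else 0)"

definition lip_topology :: "real \<Rightarrow> (complex \<Rightarrow> 'a::complex_normed_vector) topology" where
  "lip_topology \<alpha> = Metric_space.mtopology (lip_A UNIV \<alpha>) (Lip_dist \<alpha>)"

definition weighted_comp ::
    "(complex \<Rightarrow> 'a::real_normed_vector \<Rightarrow>\<^sub>L 'b::real_normed_vector) \<Rightarrow> (complex \<Rightarrow> complex) \<Rightarrow>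
     (complex \<Rightarrow> 'a) \<Rightarrow> complex \<Rightarrow> 'b" where
  "weighted_comp \<Psi> \<phi> f = (\<lambda>z. if z \<in> cball 0 1 then blinfun_apply (\<Psi> z) (f (\<phi> z)) else 0)"

definition lip_bounded ::
    "real \<Rightarrow> real \<Rightarrow>
     ((complex \<Rightarrow> 'a::complex_normed_vector) \<Rightarrow> complex \<Rightarrow> 'b::complex_normed_vector) \<Rightarrow> bool" where
  "lip_bounded \<alpha> \<beta> W \<longleftrightarrow>
     W ` lip_A UNIV \<alpha> \<subseteq> lip_A UNIV \<beta> \<and>
     (\<exists>C. \<forall>f\<in>lip_A UNIV \<alpha>. Lip_norm \<beta> (W f) \<le> C * Lip_norm \<alpha> f)"

definition lip_compact ::
    "real \<Rightarrow> real \<Rightarrow>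
     ((complex \<Rightarrow> 'a::complex_normed_vector) \<Rightarrow> complex \<Rightarrow> 'b::complex_normed_vector) \<Rightarrow> bool" where
  "lip_compact \<alpha> \<beta> W \<longleftrightarrow>
     W ` lip_A UNIV \<alpha> \<subseteq> lip_A UNIV \<beta> \<and>
     compactin (lip_topology \<beta>)
       (lip_topology \<beta> closure_of (W ` {f \<in> lip_A UNIV \<alpha>. Lip_norm \<alpha> f \<le> 1}))"

text \<open>
  On \<open>ball 0 1\<close> a nonconstant \<open>\<phi>\<close> has \<open>norm (\<phi> z) < 1\<close>, so both bases of \<open>powr\<close> are positive there. For
  \<open>\<alpha> = 1\<close> the space \<open>lip_A UNIV \<alpha>\<close> contains only constants, and the condition is not necessary for
  compactness: take \<open>\<alpha> = \<beta> = 1\<close>, complex scalars for both spaces, \<open>\<phi>\<close> and every \<open>\<Psi> z\<close> the identity.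
  The operator then has rank one, while the expression below is constantly 1. Necessity is
  therefore claimed only for \<open>\<alpha> < 1\<close>.
\<close>

definition vanishing_condition ::
    "real \<Rightarrow> real \<Rightarrow> (complex \<Rightarrow> complex) \<Rightarrow>
     (complex \<Rightarrow> 'a::real_normed_vector \<Rightarrow>\<^sub>L 'b::real_normed_vector) \<Rightarrow> bool" where
  "vanishing_condition \<alpha> \<beta> \<phi> \<Psi> \<longleftrightarrow>
     ((\<lambda>z. (1 - (norm z)\<^sup>2) powr (1 - \<beta>) / (1 - (norm (\<phi> z))\<^sup>2) powr (1 - \<alpha>)
            * norm (deriv \<phi> z) * norm (\<Psi> z)) \<longlongrightarrow> 0)
       (filtercomap norm (at_left 1))"

lemma disk_algebra_bdd:
  assumes "f \<in> disk_algebra S"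
  shows "bdd_above ((\<lambda>z. norm (f z)) ` cball 0 1)"
proof -
  have "continuous_on (cball 0 1) (\<lambda>z. norm (f z))"
    using assms by (auto simp: disk_algebra_def intro: continuous_on_norm)
  then show ?thesis
    by (meson compact_continuous_image compact_cball compact_imp_bounded bounded_imp_bdd_above)
qed

lemma disk_algebra_diff:
  assumes "f \<in> disk_algebra UNIV" "g \<in> disk_algebra UNIV"
  shows "(\<lambda>z. f z - g z) \<in> disk_algebra UNIV"
proof -
  have "\<exists>d. ((\<lambda>z. f z - g z) has_derivative (\<lambda>h. h *\<^sub>C d)) (at z)" if z: "z \<in> ball 0 1" for z
  proof -
    obtain d e where "(f has_derivative (\<lambda>h. h *\<^sub>C d)) (at z)"
      "(g has_derivative (\<lambda>h. h *\<^sub>C e)) (at z)"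
      using assms z unfolding disk_algebra_def by blast
    then have "((\<lambda>z. f z - g z) has_derivative (\<lambda>h. h *\<^sub>C d - h *\<^sub>C e)) (at z)"
      by (rule has_derivative_diff)
    moreover have "h *\<^sub>C d - h *\<^sub>C e = h *\<^sub>C (d - e)" for h
      using scaleC_add_right[of h "d - e" e] by simp
    ultimately show ?thesis by auto
  qed
  then show ?thesis
    using assms by (auto simp: disk_algebra_def intro!: continuous_on_diff)
qed

lemma Lip_quotients_nonempty: "Lip_quotients \<alpha> f \<noteq> {}"
proof -
  have "norm (f 0 - f 1) / norm (0 - 1 :: complex) powr \<alpha> \<in> Lip_quotients \<alpha> f"
    unfolding Lip_quotients_def
    by (rule CollectI, rule exI[of _ 0], rule exI[of _ 1]) simp
  then show ?thesis by blast
qed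

lemma Lip_quotient_add_le:
  fixes f g :: "complex \<Rightarrow> 'a::real_normed_vector"
  assumes "bdd_above (Lip_quotients \<alpha> f)" "bdd_above (Lip_quotients \<alpha> g)"
    "q \<in> Lip_quotients \<alpha> (\<lambda>z. f z + g z)"
  shows "q \<le> Sup (Lip_quotients \<alpha> f) + Sup (Lip_quotients \<alpha> g)"
proof -
  obtain z w where zw: "z \<in> cball 0 1" "w \<in> cball 0 1" "z \<noteq> w"
    and q: "q = norm ((f z + g z) - (f w + g w)) / norm (z - w) powr \<alpha>"
    using assms(3) by (auto simp: Lip_quotients_def)
  have "norm ((f z + g z) - (f w + g w)) \<le> norm (f z - f w) + norm (g z - g w)"
    using norm_triangle_ineq[of "f z - f w" "g z - g w"] by (simp add: algebra_simps)
  then have "q \<le> norm (f z - f w) / norm (z - w) powr \<alpha> + norm (g z - g w) / norm (z - w) powr \<alpha>"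
    unfolding q add_divide_distrib[symmetric] by (rule divide_right_mono) simp
  also have "\<dots> \<le> Sup (Lip_quotients \<alpha> f) + Sup (Lip_quotients \<alpha> g)"
    using zw assms(1,2) by (intro add_mono cSup_upper) (auto simp: Lip_quotients_def)
  finally show ?thesis .
qed

lemma Lip_quotients_uminus: "Lip_quotients \<alpha> (\<lambda>z. - f z) = Lip_quotients \<alpha> f"
proof -
  have "norm (- f z - - f w) = norm (f z - f w)" for z w
    by (simp add: norm_minus_commute)
  then show ?thesis by (simp add: Lip_quotients_def)
qed

lemma Lip_A_diff:
  assumes "f \<in> Lip_A UNIV \<alpha>" "g \<in> Lip_A UNIV \<alpha>"
  shows "(\<lambda>z. f z - g z) \<in> Lip_A UNIV \<alpha>"
proof -
  have "bdd_above (Lip_quotients \<alpha> (\<lambda>z. f z + (- g z)))"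
    using assms Lip_quotient_add_le[of \<alpha> f "\<lambda>z. - g z"]
    by (intro bdd_aboveI) (auto simp: Lip_A_def Lip_quotients_uminus)
  then show ?thesis using assms disk_algebra_diff by (auto simp: Lip_A_def)
qed

lemma Sup_Lip_quotients_nonneg:
  assumes "bdd_above (Lip_quotients \<alpha> f)"
  shows "0 \<le> Sup (Lip_quotients \<alpha> f)"
proof -
  obtain q where q: "q \<in> Lip_quotients \<alpha> f" using Lip_quotients_nonempty by blast
  then have "0 \<le> q" by (auto simp: Lip_quotients_def)
  also have "q \<le> Sup (Lip_quotients \<alpha> f)" by (rule cSup_upper[OF q assms])
  finally show ?thesis .
qed

lemma norm_le_Lip_norm:
  assumes "f \<in> Lip_A S \<alpha>" "z \<in> cball 0 1"
  shows "norm (f z) \<le> Lip_norm \<alpha> f"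
proof -
  have "norm (f z) \<le> (SUP z\<in>cball 0 1. norm (f z))"
    using assms by (intro cSUP_upper disk_algebra_bdd[of f S]) (auto simp: Lip_A_def)
  then show ?thesis
    using Sup_Lip_quotients_nonneg[of \<alpha> f] assms by (simp add: Lip_norm_def Lip_A_def)
qed

lemma Lip_norm_triangle:
  assumes "f \<in> Lip_A S \<alpha>" "g \<in> Lip_A S' \<alpha>"
  shows "Lip_norm \<alpha> (\<lambda>z. f z + g z) \<le> Lip_norm \<alpha> f + Lip_norm \<alpha> g"
proof -
  have "(SUP z\<in>cball 0 1. norm (f z + g z))
        \<le> (SUP z\<in>cball 0 1. norm (f z)) + (SUP z\<in>cball 0 1. norm (g z))"
  proof (rule cSUP_least)
    fix z :: complex assume z: "z \<in> cball 0 1"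
    have "norm (f z) \<le> (SUP z\<in>cball 0 1. norm (f z))" "norm (g z) \<le> (SUP z\<in>cball 0 1. norm (g z))"
      using assms z by (auto simp: Lip_A_def intro!: cSUP_upper disk_algebra_bdd)
    then show "norm (f z + g z)
        \<le> (SUP z\<in>cball 0 1. norm (f z)) + (SUP z\<in>cball 0 1. norm (g z))"
      using norm_triangle_ineq[of "f z" "g z"] by linarith
  qed auto
  moreover have "Sup (Lip_quotients \<alpha> (\<lambda>z. f z + g z))
        \<le> Sup (Lip_quotients \<alpha> f) + Sup (Lip_quotients \<alpha> g)"
    using assms
    by (intro cSup_least Lip_quotients_nonempty Lip_quotient_add_le) (auto simp: Lip_A_def)
  ultimately show ?thesis by (simp add: Lip_norm_def)
qed

lemma Metric_space_lip_A:
  "Metric_space (lip_A UNIV \<alpha> :: (complex \<Rightarrow> 'a::complex_normed_vector) set) (Lip_dist \<alpha>)"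
proof
  have uminus: "Lip_norm \<alpha> (\<lambda>z. - f z) = Lip_norm \<alpha> f" for f :: "complex \<Rightarrow> 'a"
    by (simp add: Lip_norm_def Lip_quotients_uminus)
  show "Lip_dist \<alpha> f g = Lip_dist \<alpha> g f" for f g :: "complex \<Rightarrow> 'a"
    using uminus[of "\<lambda>z. f z - g z"] by (simp add: Lip_dist_def)
  have zero: "Lip_norm \<alpha> (\<lambda>z. 0 :: 'a) = 0"
  proof -
    have "Lip_quotients \<alpha> (\<lambda>z. 0 :: 'a) = {0}"
      using Lip_quotients_nonempty[of \<alpha> "\<lambda>z. 0 :: 'a"] by (auto simp: Lip_quotients_def)
    then show ?thesis by (simp add: Lip_norm_def)
  qed
  have sub: "f \<in> Lip_A UNIV \<alpha>" if "f \<in> lip_A UNIV \<alpha>" for f :: "complex \<Rightarrow> 'a"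
    using that by (simp add: lip_A_def)
  show "0 \<le> Lip_dist \<alpha> f g" for f g :: "complex \<Rightarrow> 'a"
  proof -
    have "0 \<le> Lip_norm \<alpha> h" if "h \<in> Lip_A UNIV \<alpha>" for h :: "complex \<Rightarrow> 'a"
      using norm_le_Lip_norm[OF that, of 0] norm_ge_zero[of "h 0"] by (simp del: norm_ge_zero)
    then show ?thesis using Lip_A_diff[OF sub sub] by (simp add: Lip_dist_def)
  qed
  show "Lip_dist \<alpha> f g = 0 \<longleftrightarrow> f = g" if "f \<in> lip_A UNIV \<alpha>" "g \<in> lip_A UNIV \<alpha>"
    for f g :: "complex \<Rightarrow> 'a"
  proof
    assume 0: "Lip_dist \<alpha> f g = 0"
    show "f = g"
    proof
      fix z
      show "f z = g z"
      proof (cases "z \<in> cball 0 1")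
        case True
        then show ?thesis
          using norm_le_Lip_norm[OF Lip_A_diff[OF sub sub, OF that] True] 0
          by (simp add: Lip_dist_def that)
      next
        case False
        then show ?thesis using that by (simp add: lip_A_def Lip_A_def disk_algebra_def)
      qed
    qed
  qed (simp add: Lip_dist_def zero)
  show "Lip_dist \<alpha> f h \<le> Lip_dist \<alpha> f g + Lip_dist \<alpha> g h"
    if "f \<in> lip_A UNIV \<alpha>" "g \<in> lip_A UNIV \<alpha>" "h \<in> lip_A UNIV \<alpha>" for f g h :: "complex \<Rightarrow> 'a"
    using Lip_norm_triangle[OF Lip_A_diff Lip_A_diff, OF sub sub sub sub, OF that(1,2,2,3)] that
    by (simp add: Lip_dist_def)
qed

end

theory Submission
  imports Defs "HOL-Complex_Analysis.Conformal_Mappings"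
begin

text \<open>
  Write \<open>W\<close> for the weighted composition operator. A subset of the little Lipschitz space is
  relatively compact iff its values at each point form a relatively compact set and the
  little-\<open>o\<close> condition that defines the space holds for all its members with the same \<open>\<delta>\<close>
  (\<open>uniformly_lip\<close>). Necessity is clear from finite nets
  (\<open>uniformly_lip_totally_bounded\<close>, \<open>pointwise_totally_bounded\<close>). Sufficiency is an
  Arzela-Ascoli argument (\<open>totally_bounded_uniformly_lip\<close>) together with completeness
  (\<open>mcomplete_lip_A\<close>). The theorem results from applying this to the image of the unit ball
  under \<open>W\<close>.

  Since the constants of norm at most 1 lie in the unit ball, the pointwise condition says that
  every \<open>\<Psi> z\<close> is a compact operator, and boundedness of \<open>W\<close> on constants makes \<open>\<Psi>\<close> Lipschitz of
  order \<open>\<beta>\<close> in the operator norm.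

  The uniform condition becomes a condition on derivatives. If \<open>g\<close> satisfies it with constant
  \<open>\<epsilon>\<close> at small distances, then Cauchy's estimate on a disk about \<open>z\<close> of radius proportional to
  \<open>1 - |z|\<^sup>2\<close> gives \<open>\<parallel>g'(z)\<parallel> \<le> 4 \<epsilon> (1 - |z|\<^sup>2) powr (\<beta> - 1)\<close> near the unit circle
  (\<open>derivative_le_powr\<close>). Conversely, by Hardy and Littlewood, such a bound near the circle,
  with any bound inside, can be integrated along a path that steps away from the circle
  (\<open>Hardy_Littlewood\<close>), and for \<open>\<beta> < 1\<close> the contribution from inside is negligible at small
  distances. For \<open>\<beta> = 1\<close> the little Lipschitz space contains only constants
  (\<open>lip_A_one_constant\<close>) and the uniform condition is void.

  For \<open>g = W f\<close> the derivative is \<open>\<Psi>'(z) f(\<phi> z) + \<phi>'(z) \<Psi>(z) f'(\<phi> z)\<close>. On the unit ball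
  \<open>\<parallel>f'(u)\<parallel> \<le> 4 (1 - |u|\<^sup>2) powr (\<alpha> - 1)\<close>, so that the vanishing condition controls the second
  term, while the first is controlled by the hypothesis that \<open>\<Psi>\<close> belongs to the little Lipschitz
  space. In the other direction, for \<open>\<alpha> < 1\<close>, take for each \<open>z\<close> a multiple of
  \<open>(1 - |a|\<^sup>2) powr \<alpha>\<close> times the disk automorphism that sends \<open>a = \<phi> z\<close> to 0
  (\<open>test_function\<close>). It stays in the unit ball, it annihilates the first term, and its
  derivative at \<open>a\<close> has the largest possible order of magnitude, so that the bound on the
  derivative of \<open>W f\<close> is the vanishing condition.

  All functions take values in Banach spaces. Cauchy's estimate is reduced to the scalar case by a
  complex linear functional of norm at most 1 that attains the norm of a given vector
  (\<open>norming_functional\<close>), a form of the Hahn-Banach theorem.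
\<close>

section \<open>Complex scalar multiplication\<close>

lemma scaleC_zero_right: "a *\<^sub>C (0 :: 'a::complex_normed_vector) = 0"
proof -
  have "norm (a *\<^sub>C (0 :: 'a)) = 0" unfolding norm_scaleC by simp
  then show ?thesis by simp
qed

lemma scaleC_zero_left: "0 *\<^sub>C (x :: 'a::complex_normed_vector) = 0"
proof -
  have "norm (0 *\<^sub>C x) = 0" unfolding norm_scaleC by simp
  then show ?thesis by simp
qed

lemma scaleC_diff_right: "a *\<^sub>C (x - y) = a *\<^sub>C x - a *\<^sub>C (y :: 'a::complex_normed_vector)"
  using scaleC_add_right[of a "x - y" y] by simp

section \<open>Norming functionals\<close>

text \<open>
  An inequality is enough in the homogeneity clause: used for \<open>c\<close> and for \<open>1 / c\<close> it gives
  equality.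
\<close>

definition sublinear :: "('a::real_vector \<Rightarrow> real) \<Rightarrow> bool" where
  "sublinear p \<longleftrightarrow>
     (\<forall>x y. p (x + y) \<le> p x + p y) \<and> (\<forall>c x. 0 \<le> c \<longrightarrow> p (c *\<^sub>R x) \<le> c * p x)"

lemma sublinearD:
  assumes "sublinear p"
  shows "p (x + y) \<le> p x + p y" "0 \<le> c \<Longrightarrow> p (c *\<^sub>R x) = c * p x" "p 0 = 0" "- p (- x) \<le> p x"
proof -
  show add: "p (x + y) \<le> p x + p y" for x y
    using assms by (simp add: sublinear_def)
  have hom: "p (c *\<^sub>R x) \<le> c * p x" if "0 \<le> c" for c x
    using assms that by (simp add: sublinear_def)
  show 0: "p 0 = 0"
    using hom[of 0 0] add[of 0 0] by simp
  show "- p (- x) \<le> p x"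
    using add[of x "- x"] 0 by simp
  show "p (c *\<^sub>R x) = c * p x" if "0 \<le> c"
  proof (cases "c = 0")
    case False
    with that have "c > 0" by simp
    then have "c * p x \<le> c * (inverse c * p (c *\<^sub>R x))"
      using hom[of "inverse c" "c *\<^sub>R x"] by (intro mult_left_mono) auto
    then show ?thesis using hom[OF that, of x] \<open>c > 0\<close> by (simp add: field_simps)
  qed (simp add: 0)
qed

text \<open>
  Infima along chains provide the lower bounds that Zorn's lemma needs. The chain condition gives
  subadditivity: the smaller of two members serves both summands. The infimum is finite because
  \<open>p x \<ge> - p (- x) \<ge> - q (- x)\<close>.
\<close>

lemma sublinear_INF_chain:
  fixes q :: "'a::real_vector \<Rightarrow> real"
  assumes C: "C \<noteq> {}" "\<forall>p\<in>C. sublinear p \<and> p \<le> q"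
    and chain: "\<forall>p\<in>C. \<forall>p'\<in>C. p \<le> p' \<or> p' \<le> p"
  shows "sublinear (\<lambda>x. INF p\<in>C. p x)" "\<And>p. p \<in> C \<Longrightarrow> (\<lambda>x. INF p\<in>C. p x) \<le> p"
proof -
  let ?u = "\<lambda>x. INF p\<in>C. p x"
  have bdd: "bdd_below ((\<lambda>p. p x) ` C)" for x
  proof (rule bdd_belowI2)
    fix p assume p: "p \<in> C"
    have "p (- x) \<le> q (- x)" using C(2) p by (auto simp: le_fun_def)
    then show "- q (- x) \<le> p x"
      using sublinearD(4)[of p x] C(2) p by auto
  qed
  have le: "?u x \<le> p x" if "p \<in> C" for p x
    by (rule cINF_lower[OF bdd that])
  then show "\<And>p. p \<in> C \<Longrightarrow> ?u \<le> p" by (simp add: le_fun_def)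
  have "?u (x + y) \<le> ?u x + ?u y" for x y
  proof -
    have *: "?u (x + y) \<le> p x + p' y" if p: "p \<in> C" "p' \<in> C" for p p'
    proof -
      obtain r where r: "r \<in> C" "r \<le> p" "r \<le> p'" using chain p by blast
      have "?u (x + y) \<le> r (x + y)" by (rule le[OF r(1)])
      also have "\<dots> \<le> r x + r y" using sublinearD(1) C(2) r(1) by blast
      also have "\<dots> \<le> p x + p' y" using r by (auto simp: le_fun_def intro: add_mono)
      finally show ?thesis .
    qed
    have "?u (x + y) - p' y \<le> ?u x" if "p' \<in> C" for p'
      using *[OF _ that] by (intro cINF_greatest C) (auto simp: algebra_simps)
    then have "?u (x + y) - ?u x \<le> ?u y"
      by (intro cINF_greatest C) (simp add: algebra_simps)
    then show ?thesis by simp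
  qed
  moreover have "?u (c *\<^sub>R x) \<le> c * ?u x" if c: "0 \<le> c" for c x
  proof (cases "c = 0")
    case True
    obtain p where p: "p \<in> C" using C by blast
    show ?thesis using le[OF p, of 0] sublinearD(3)[of p] C(2) p True by simp
  next
    case False
    with c have "c > 0" by simp
    have "?u (c *\<^sub>R x) / c \<le> ?u x"
    proof (rule cINF_greatest[OF C(1)])
      fix p assume p: "p \<in> C"
      show "?u (c *\<^sub>R x) / c \<le> p x"
        using le[OF p, of "c *\<^sub>R x"] sublinearD(2)[OF _ c, of p x] C(2) p \<open>c > 0\<close>
        by (simp add: field_simps)
    qed
    then show ?thesis using \<open>c > 0\<close> by (simp add: field_simps)
  qed
  ultimately show "sublinear ?u" by (simp add: sublinear_def)
qed

text \<open>
  The infimum over \<open>t \<ge> 0\<close> of \<open>p (x + t y) - t (p y)\<close> lowers \<open>p\<close> just enough to make it odd in the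
  direction \<open>y\<close>: \<open>t = 0\<close> shows \<open>q \<le> p\<close>, and \<open>t = 1\<close> bounds the value at \<open>- y\<close>.
\<close>

lemma sublinear_shift:
  fixes p :: "'a::real_vector \<Rightarrow> real"
  assumes p: "sublinear p"
  obtains q where "sublinear q" "q \<le> p" "q (- y) \<le> - p y"
proof
  define q where "q = (\<lambda>x. INF t\<in>{0::real..}. p (x + t *\<^sub>R y) - t * p y)"
  have le: "q x \<le> p (x + t *\<^sub>R y) - t * p y" if "0 \<le> t" for x t
    unfolding q_def
  proof (rule cINF_lower)
    show "bdd_below ((\<lambda>t. p (x + t *\<^sub>R y) - t * p y) ` {0..})"
    proof (rule bdd_belowI2)
      fix t :: real assume "t \<in> {0..}"
      then show "- p (- x) \<le> p (x + t *\<^sub>R y) - t * p y"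
        using sublinearD(1)[OF p, of "x + t *\<^sub>R y" "- x"] sublinearD(2)[OF p, of t y] by simp
    qed
  qed (use that in auto)
  show "q \<le> p" using le[of 0] by (simp add: le_fun_def)
  show "q (- y) \<le> - p y" using le[of 1 "- y"] sublinearD(3)[OF p] by simp
  have ge: "c \<le> q x" if "\<And>t. 0 \<le> t \<Longrightarrow> c \<le> p (x + t *\<^sub>R y) - t * p y" for c x
    unfolding q_def using that by (intro cINF_greatest) auto
  have "q (x1 + x2) \<le> q x1 + q x2" for x1 x2
  proof -
    have *: "q (x1 + x2) \<le> (p (x1 + s *\<^sub>R y) - s * p y) + (p (x2 + t *\<^sub>R y) - t * p y)"
      if "0 \<le> s" "0 \<le> t" for s t
      using le[of "s + t" "x1 + x2"] that sublinearD(1)[OF p, of "x1 + s *\<^sub>R y" "x2 + t *\<^sub>R y"]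
      by (simp add: algebra_simps)
    have "q (x1 + x2) - (p (x2 + t *\<^sub>R y) - t * p y) \<le> q x1" if "0 \<le> t" for t
      using *[OF _ that] by (intro ge) (simp add: algebra_simps)
    then have "q (x1 + x2) - q x1 \<le> q x2"
      by (intro ge) (simp add: algebra_simps)
    then show ?thesis by simp
  qed
  moreover have "q (c *\<^sub>R x) \<le> c * q x" if c: "0 \<le> c" for c x
  proof (cases "c = 0")
    case True
    show ?thesis using le[of 0 0] True sublinearD(3)[OF p] by simp
  next
    case False
    with c have "c > 0" by simp
    have "q (c *\<^sub>R x) / c \<le> q x"
    proof (rule ge)
      fix t :: real assume t: "0 \<le> t"
      have "q (c *\<^sub>R x) \<le> p (c *\<^sub>R x + (c * t) *\<^sub>R y) - c * t * p y"
        using le[of "c * t" "c *\<^sub>R x"] c t by simp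
      also have "c *\<^sub>R x + (c * t) *\<^sub>R y = c *\<^sub>R (x + t *\<^sub>R y)"
        by (simp add: algebra_simps)
      finally show "q (c *\<^sub>R x) / c \<le> p (x + t *\<^sub>R y) - t * p y"
        using \<open>c > 0\<close> sublinearD(2)[OF p c, of "x + t *\<^sub>R y"] by (simp add: field_simps)
    qed
    then show ?thesis using \<open>c > 0\<close> by (simp add: field_simps)
  qed
  ultimately show "sublinear q" by (simp add: sublinear_def)
qed

text \<open>
  A minimal sublinear functional cannot be lowered by \<open>sublinear_shift\<close>, so it is odd; an odd
  sublinear functional is linear. Zorn's lemma gives a minimal one below \<open>q\<close>.
\<close>

lemma linear_minorant:
  fixes q :: "'a::real_vector \<Rightarrow> real"
  assumes q: "sublinear q"
  obtains f where "linear f" "f \<le> q"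
proof -
  define A where "A = {p. sublinear p \<and> p \<le> q}"
  have "\<exists>m\<in>A. \<forall>p\<in>A. m \<ge> p \<longrightarrow> p = m"
  proof (rule predicate_Zorn)
    show "partial_order_on A (relation_of (\<ge>) A)"
      by (rule partial_order_on_relation_ofI) auto
    fix C assume C: "C \<in> Chains (relation_of (\<ge>) A)"
    show "\<exists>u\<in>A. \<forall>p\<in>C. p \<ge> u"
    proof (cases "C = {}")
      case True
      then show ?thesis using q by (auto simp: A_def)
    next
      case False
      have CA: "\<forall>p\<in>C. sublinear p \<and> p \<le> q"
        using C by (auto simp: Chains_def relation_of_def A_def)
      have ch: "\<forall>p\<in>C. \<forall>p'\<in>C. p \<le> p' \<or> p' \<le> p"
        using C by (auto simp: Chains_def relation_of_def)
      note u = sublinear_INF_chain[OF False CA ch]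
      obtain p where p: "p \<in> C" using False by blast
      have "(\<lambda>x. INF p\<in>C. p x) \<le> q" using u(2)[OF p] CA p by (auto intro: order_trans)
      then show ?thesis using u by (auto simp: A_def)
    qed
  qed
  then obtain m where m: "sublinear m" "m \<le> q" and min: "\<And>p. sublinear p \<Longrightarrow> p \<le> m \<Longrightarrow> p = m"
    unfolding A_def by (auto intro: order_trans)
  have odd: "m (- y) = - m y" for y
  proof -
    obtain p where "sublinear p" "p \<le> m" "p (- y) \<le> - m y" by (rule sublinear_shift[OF m(1)])
    with min[of p] sublinearD(4)[OF m(1), of "- y"] show ?thesis by simp
  qed
  have "linear m"
  proof (rule linearI)
    fix x y
    have "m ((- x) + (- y)) \<le> m (- x) + m (- y)" by (rule sublinearD(1)[OF m(1)])
    then have "m x + m y \<le> m (x + y)" using odd[of "x + y"] by (simp add: odd)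
    with sublinearD(1)[OF m(1), of x y] show "m (x + y) = m x + m y" by simp
  next
    fix c x
    show "m (c *\<^sub>R x) = c *\<^sub>R m x"
    proof (cases "0 \<le> c")
      case False
      then have "m (- ((- c) *\<^sub>R x)) = c * m x"
        using sublinearD(2)[OF m(1), of "- c" x] by (subst odd) simp
      then show ?thesis by simp
    qed (simp add: sublinearD(2)[OF m(1)])
  qed
  with m(2) show ?thesis using that by blast
qed

lemma norming_real_functional:
  fixes y :: "'a::real_normed_vector"
  obtains f where "linear f" "\<And>x. f x \<le> norm x" "f y = norm y"
proof -
  have "sublinear (norm :: 'a \<Rightarrow> real)" by (simp add: sublinear_def norm_triangle_ineq)
  \<comment> \<open>The shift in the direction y forces every linear minorant to take the value norm y at y.\<close>
  then obtain q where q: "sublinear q" "q \<le> norm" "q (- y) \<le> - norm y"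
    by (rule sublinear_shift)
  obtain f where f: "linear f" "f \<le> q" using linear_minorant[OF q(1)] .
  have le: "f x \<le> norm x" for x using f q by (meson le_funD order_trans)
  have "f (- y) \<le> - norm y" using f q by (meson le_funD order_trans)
  then have "f y = norm y" using le[of y] linear_neg[OF f(1), of y] by simp
  with f(1) le show ?thesis using that by blast
qed

text \<open>
  A complex linear functional is determined by its real part \<open>f\<close>, as \<open>f x - \<i> f (\<i> x)\<close>.
\<close>

lemma norming_functional:
  fixes y :: "'a::complex_normed_vector"
  obtains l :: "'a \<Rightarrow> complex" where "bounded_linear l" "\<And>a x. l (a *\<^sub>C x) = a * l x"
    "\<And>x. norm (l x) \<le> norm x" "norm (l y) = norm y"
proof -
  obtain f where f: "linear f" "\<And>x. f x \<le> norm x" "f y = norm y"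
    using norming_real_functional[of y] by blast
  define l where "l x = Complex (f x) (- f (\<i> *\<^sub>C x))" for x
  have add: "l (x + x') = l x + l x'" for x x'
    by (simp add: l_def complex_eq_iff scaleC_add_right linear_add[OF f(1)])
  have real: "l (complex_of_real r *\<^sub>C x) = complex_of_real r * l x" for r x
  proof -
    have "\<i> *\<^sub>C r *\<^sub>R x = r *\<^sub>R \<i> *\<^sub>C x"
      by (metis scaleC_of_real scaleC_scaleC mult.commute)
    then show ?thesis
      by (simp add: l_def complex_eq_iff scaleC_of_real linear_scale[OF f(1)])
  qed
  have imag: "l (\<i> *\<^sub>C x) = \<i> * l x" for x
  proof -
    have "\<i> *\<^sub>C \<i> *\<^sub>C x = - x"
      using scaleC_of_real[of "- 1" x] by (simp add: scaleC_scaleC)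
    then show ?thesis
      by (simp add: l_def complex_eq_iff linear_neg[OF f(1)])
  qed
  have scale: "l (a *\<^sub>C x) = a * l x" for a x
  proof -
    have "l (a *\<^sub>C x) = l (complex_of_real (Re a) *\<^sub>C x + complex_of_real (Im a) *\<^sub>C \<i> *\<^sub>C x)"
      by (simp add: scaleC_scaleC flip: scaleC_add_left)
         (metis complex_eq mult.commute)
    also have "\<dots> = (complex_of_real (Re a) + complex_of_real (Im a) * \<i>) * l x"
      by (simp only: add real imag algebra_simps)
    also have "\<dots> = a * l x" by (metis complex_eq mult.commute)
    finally show ?thesis .
  qed
  have le: "norm (l x) \<le> norm x" for x
  proof (cases "l x = 0")
    case False
    \<comment> \<open>A rotation makes the value real, so that the bound for the real part applies.\<close>
    define c where "c = cnj (l x) / norm (l x)"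
    have "norm c = 1" using False by (simp add: c_def norm_divide)
    have "l (c *\<^sub>C x) = complex_of_real (norm (l x))"
      using False by (simp add: scale c_def complex_norm_square[symmetric] power2_eq_square
          mult.commute[of "cnj (l x)"])
    then have "norm (l x) = f (c *\<^sub>C x)" by (simp add: l_def complex_eq_iff)
    also have "\<dots> \<le> norm (c *\<^sub>C x)" by (rule f(2))
    finally show ?thesis by (simp add: norm_scaleC \<open>norm c = 1\<close>)
  qed simp
  have "bounded_linear l"
    using add real le
    by (intro bounded_linear_intro[where K = 1])
       (auto simp: scaleR_conv_of_real simp flip: scaleC_of_real)
  moreover have "norm (l y) = norm y"
    using le[of y] abs_Re_le_cmod[of "l y"] f(3) by (simp add: l_def)
  ultimately show ?thesis using that scale le by blast
qed

text \<open>
  The scalar estimate, applied to \<open>F - c\<close> followed by a functional that norms the derivative. The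
  constant \<open>c\<close> allows \<open>B\<close> to bound the oscillation of \<open>F\<close> only.
\<close>

lemma Cauchy_estimate:
  fixes F :: "complex \<Rightarrow> 'a::complex_normed_vector"
  assumes der: "\<And>u. u \<in> ball z R \<Longrightarrow> \<exists>d. (F has_derivative (\<lambda>h. h *\<^sub>C d)) (at u)"
    and D: "(F has_derivative (\<lambda>h. h *\<^sub>C D)) (at z)"
    and r: "0 < r" "r < R"
    and B: "\<And>u. dist z u = r \<Longrightarrow> norm (F u - c) \<le> B"
  shows "norm D \<le> B / r"
proof -
  obtain l :: "'a \<Rightarrow> complex" where l: "bounded_linear l" "\<And>a x. l (a *\<^sub>C x) = a * l x"
    "\<And>x. norm (l x) \<le> norm x" "norm (l D) = norm D"
    using norming_functional[of D] by blast
  define g where "g u = l (F u - c)" for u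
  have g': "(g has_field_derivative l d) (at u)"
    if "(F has_derivative (\<lambda>h. h *\<^sub>C d)) (at u)" for u d
  proof -
    have "(g has_derivative (\<lambda>h. l (h *\<^sub>C d - 0))) (at u)"
      unfolding g_def
      by (intro bounded_linear.has_derivative[OF l(1)] has_derivative_diff that has_derivative_const)
    then show ?thesis
      by (simp add: has_field_derivative_def l(2) mult_commute_abs)
  qed
  have hol: "g holomorphic_on ball z R"
    unfolding holomorphic_on_def field_differentiable_def
    using der g' by (meson has_field_derivative_at_within)
  have sub: "cball z r \<subseteq> ball z R" using r by auto
  have "norm ((deriv ^^ 1) g z) \<le> fact 1 * B / r ^ 1"
  proof (rule Cauchy_inequality)
    show "g holomorphic_on ball z r"
      using hol sub by (meson ball_subset_cball holomorphic_on_subset order_trans)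
    show "continuous_on (cball z r) g"
      using hol sub by (meson holomorphic_on_imp_continuous_on holomorphic_on_subset)
    show "norm (g u) \<le> B" if "norm (z - u) = r" for u
      using l(3)[of "F u - c"] B[of u] that by (auto simp: g_def dist_norm)
  qed (use r in auto)
  moreover have "deriv g z = l D" by (rule DERIV_imp_deriv[OF g'[OF D]])
  ultimately show ?thesis by (simp add: l(4))
qed

section \<open>Uniform little Lipschitz conditions\<close>

definition uniformly_lip ::
    "real \<Rightarrow> (complex \<Rightarrow> 'a::real_normed_vector) set \<Rightarrow> bool" where
  "uniformly_lip \<alpha> M \<longleftrightarrow> (\<forall>\<epsilon>>0. \<exists>\<delta>>0. \<forall>f\<in>M. \<forall>z\<in>cball 0 1. \<forall>w\<in>cball 0 1.
     norm (z - w) < \<delta> \<longrightarrow> norm (f z - f w) \<le> \<epsilon> * norm (z - w) powr \<alpha>)"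

lemma uniformly_lipD:
  assumes "uniformly_lip \<alpha> M" "0 < \<epsilon>"
  obtains \<delta> where "0 < \<delta>" "\<And>f z w. f \<in> M \<Longrightarrow> z \<in> cball 0 1 \<Longrightarrow> w \<in> cball 0 1 \<Longrightarrow>
     norm (z - w) < \<delta> \<Longrightarrow> norm (f z - f w) \<le> \<epsilon> * norm (z - w) powr \<alpha>"
proof -
  obtain \<delta> where "0 < \<delta>" "\<forall>f\<in>M. \<forall>z\<in>cball 0 1. \<forall>w\<in>cball 0 1.
      norm (z - w) < \<delta> \<longrightarrow> norm (f z - f w) \<le> \<epsilon> * norm (z - w) powr \<alpha>"
    using assms unfolding uniformly_lip_def by blast
  then show ?thesis using that by blast
qed

lemma Lip_A_le:
  assumes "f \<in> Lip_A S \<alpha>" "z \<in> cball 0 1" "w \<in> cball 0 1"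
  shows "norm (f z - f w) \<le> Lip_norm \<alpha> f * norm (z - w) powr \<alpha>"
proof (cases "z = w")
  case False
  have "0 \<le> norm (f 0)" by simp
  also have "\<dots> \<le> (SUP z\<in>cball 0 1. norm (f z))"
    using assms by (intro cSUP_upper disk_algebra_bdd[of f S]) (auto simp: Lip_A_def)
  finally have *: "0 \<le> (SUP z\<in>cball 0 1. norm (f z))" .
  have "norm (f z - f w) / norm (z - w) powr \<alpha> \<le> Sup (Lip_quotients \<alpha> f)"
    using assms False by (intro cSup_upper) (auto simp: Lip_A_def Lip_quotients_def)
  with * have "norm (f z - f w) / norm (z - w) powr \<alpha> \<le> Lip_norm \<alpha> f"
    by (simp add: Lip_norm_def)
  then show ?thesis using False by (simp add: field_simps)
qed auto

lemma Lip_quotients_le: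
  assumes "\<And>z w. z \<in> cball 0 1 \<Longrightarrow> w \<in> cball 0 1 \<Longrightarrow> norm (f z - f w) \<le> b * norm (z - w) powr \<alpha>"
  shows "\<And>q. q \<in> Lip_quotients \<alpha> f \<Longrightarrow> q \<le> b" and "bdd_above (Lip_quotients \<alpha> f)"
proof -
  show b: "q \<le> b" if "q \<in> Lip_quotients \<alpha> f" for q
    using that assms by (auto simp: Lip_quotients_def field_simps)
  then show "bdd_above (Lip_quotients \<alpha> f)" by (rule bdd_aboveI)
qed

lemma Lip_norm_le:
  assumes "\<And>z. z \<in> cball 0 1 \<Longrightarrow> norm (f z) \<le> a"
    and "\<And>z w. z \<in> cball 0 1 \<Longrightarrow> w \<in> cball 0 1 \<Longrightarrow> norm (f z - f w) \<le> b * norm (z - w) powr \<alpha>"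
  shows "Lip_norm \<alpha> f \<le> a + b"
proof -
  have "(SUP z\<in>cball 0 1. norm (f z)) \<le> a" using assms(1) by (intro cSUP_least) auto
  moreover have "Sup (Lip_quotients \<alpha> f) \<le> b"
    by (intro cSup_least Lip_quotients_nonempty Lip_quotients_le(1)[OF assms(2)])
  ultimately show "Lip_norm \<alpha> f \<le> a + b" by (simp add: Lip_norm_def)
qed

text \<open>
  For a single function the uniform condition is the defining one; the difference between \<open>\<epsilon>\<close> with
  \<open><\<close> and \<open>\<epsilon> / 2\<close> with \<open>\<le>\<close> is absorbed by the quantifiers.
\<close>

lemma lip_A_iff:
  "f \<in> lip_A S \<alpha> \<longleftrightarrow> f \<in> Lip_A S \<alpha> \<and> uniformly_lip \<alpha> {f}"
proof -
  have 1: "norm (f z - f w) \<le> \<epsilon> * norm (z - w) powr \<alpha>"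
    if "0 < norm (z - w) \<longrightarrow> norm (f z - f w) / norm (z - w) powr \<alpha> < \<epsilon>" for z w \<epsilon>
    using that by (cases "z = w") (auto simp: field_simps)
  have 2: "norm (f z - f w) / norm (z - w) powr \<alpha> < \<epsilon>"
    if "norm (f z - f w) \<le> \<epsilon> / 2 * norm (z - w) powr \<alpha>" "0 < norm (z - w)" "0 < \<epsilon>" for z w \<epsilon>
  proof -
    have "norm (f z - f w) / norm (z - w) powr \<alpha> \<le> \<epsilon> / 2"
      using that by (simp add: field_simps)
    also have "\<dots> < \<epsilon>" using that by simp
    finally show ?thesis .
  qed
  show ?thesis
  proof (intro iffI conjI)
    assume f: "f \<in> lip_A S \<alpha>"
    then show "f \<in> Lip_A S \<alpha>" by (simp add: lip_A_def)
    show "uniformly_lip \<alpha> {f}"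
      unfolding uniformly_lip_def
    proof (intro allI impI)
      fix \<epsilon> :: real assume "0 < \<epsilon>"
      then obtain \<delta> where \<delta>: "0 < \<delta>" "\<forall>z\<in>cball 0 1. \<forall>w\<in>cball 0 1. 0 < norm (z - w) \<and> norm (z - w) < \<delta> \<longrightarrow>
          norm (f z - f w) / norm (z - w) powr \<alpha> < \<epsilon>"
        using f unfolding lip_A_def by blast
      show "\<exists>\<delta>>0. \<forall>f\<in>{f}. \<forall>z\<in>cball 0 1. \<forall>w\<in>cball 0 1.
          norm (z - w) < \<delta> \<longrightarrow> norm (f z - f w) \<le> \<epsilon> * norm (z - w) powr \<alpha>"
      proof (intro exI[of _ \<delta>] conjI ballI impI \<delta>(1))
        fix g and z w :: complex
        assume "g \<in> {f}" "z \<in> cball 0 1" "w \<in> cball 0 1" "norm (z - w) < \<delta>"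
        then show "norm (g z - g w) \<le> \<epsilon> * norm (z - w) powr \<alpha>"
          using \<delta>(2) 1[of z w \<epsilon>] by blast
      qed
    qed
  next
    assume f: "f \<in> Lip_A S \<alpha> \<and> uniformly_lip \<alpha> {f}"
    show "f \<in> lip_A S \<alpha>"
      unfolding lip_A_def
    proof (clarify, intro conjI allI impI)
      show "f \<in> Lip_A S \<alpha>" using f by simp
      fix \<epsilon> :: real assume "0 < \<epsilon>"
      then have "0 < \<epsilon> / 2" by simp
      then obtain \<delta> where \<delta>: "0 < \<delta>" "\<And>g z w. g \<in> {f} \<Longrightarrow> z \<in> cball 0 1 \<Longrightarrow> w \<in> cball 0 1 \<Longrightarrow>
         norm (z - w) < \<delta> \<Longrightarrow> norm (g z - g w) \<le> \<epsilon> / 2 * norm (z - w) powr \<alpha>"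
        by (rule uniformly_lipD[OF conjunct2[OF f]]) blast
      show "\<exists>\<delta>>0. \<forall>z\<in>cball 0 1. \<forall>w\<in>cball 0 1. 0 < norm (z - w) \<and> norm (z - w) < \<delta> \<longrightarrow>
       norm (f z - f w) / norm (z - w) powr \<alpha> < \<epsilon>"
        by (intro exI[of _ \<delta>] conjI \<delta>(1) ballI impI) (auto intro!: 2 \<delta>(2) \<open>0 < \<epsilon>\<close>)
    qed
  qed
qed

section \<open>Lipschitz conditions and growth of the derivative\<close>

lemma one_minus_norm_square_le:
  "(1 - (norm z)\<^sup>2) / 2 \<le> 1 - norm z"
proof -
  have "(1 - norm z)\<^sup>2 \<ge> 0" by simp
  then show ?thesis unfolding power2_diff by simp
qed

lemma ball_subset_unit_ball:
  fixes z :: complex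
  assumes "norm z < 1"
  shows "ball z ((1 - (norm z)\<^sup>2) / 2) \<subseteq> ball 0 1" "0 < 1 - (norm z)\<^sup>2"
proof -
  show "ball z ((1 - (norm z)\<^sup>2) / 2) \<subseteq> ball 0 1"
  proof
    fix u assume "u \<in> ball z ((1 - (norm z)\<^sup>2) / 2)"
    then have "norm (u - z) < 1 - norm z"
      using one_minus_norm_square_le[of z] by (simp add: dist_norm norm_minus_commute)
    then show "u \<in> ball 0 1" using norm_triangle_ineq2[of u z] by simp
  qed
  show "0 < 1 - (norm z)\<^sup>2" using assms by (simp add: power_less_one_iff abs_square_less_1)
qed

lemma disk_algebra_derivative:
  assumes "f \<in> disk_algebra S" "norm z < 1"
  obtains d where "d \<in> S" "(f has_derivative (\<lambda>h. h *\<^sub>C d)) (at z)"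
proof -
  have "z \<in> ball 0 1" using assms(2) by simp
  then obtain d where "d \<in> S" "(f has_derivative (\<lambda>h. h *\<^sub>C d)) (at z)"
    using assms(1) unfolding disk_algebra_def by blast
  then show ?thesis by (rule that)
qed

text \<open>
  Cauchy's estimate on the circle of radius \<open>(1 - |z|\<^sup>2) / 4\<close>, whose closed disk lies inside the unit
  disk. The oscillation needs to be controlled only at that distance from \<open>z\<close>, so a local Lipschitz
  condition is enough when \<open>z\<close> is near the unit circle.
\<close>

lemma derivative_le_powr:
  assumes f: "f \<in> disk_algebra S" and z: "norm z < 1"
    and D: "(f has_derivative (\<lambda>h. h *\<^sub>C D)) (at z)"
    and \<alpha>: "0 < \<alpha>" and K: "0 \<le> K"
    and le: "\<And>u. u \<in> cball 0 1 \<Longrightarrow> norm (u - z) = (1 - (norm z)\<^sup>2) / 4 \<Longrightarrow>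
       norm (f u - f z) \<le> K * norm (u - z) powr \<alpha>"
  shows "norm D \<le> 4 * K * (1 - (norm z)\<^sup>2) powr (\<alpha> - 1)"
proof -
  define r where "r = (1 - (norm z)\<^sup>2) / 4"
  note b = ball_subset_unit_ball[OF z]
  have r: "0 < r" "r < (1 - (norm z)\<^sup>2) / 2" using b(2) by (auto simp: r_def)
  have "norm D \<le> (K * r powr \<alpha>) / r"
  proof (rule Cauchy_estimate[OF _ D r])
    show "\<exists>d. (f has_derivative (\<lambda>h. h *\<^sub>C d)) (at u)" if "u \<in> ball z ((1 - (norm z)\<^sup>2) / 2)" for u
    proof -
      have "norm u < 1" using b(1) that by auto
      then show ?thesis using disk_algebra_derivative[OF f] by blast
    qed
    show "norm (f u - f z) \<le> K * r powr \<alpha>" if "dist z u = r" for u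
    proof -
      have "u \<in> ball z ((1 - (norm z)\<^sup>2) / 2)" using that r by simp
      then have "u \<in> cball 0 1" using b(1) by auto
      moreover have nu: "norm (u - z) = r" using that by (simp add: dist_norm norm_minus_commute)
      ultimately have "norm (f u - f z) \<le> K * norm (u - z) powr \<alpha>" by (intro le) (simp_all add: r_def)
      then show ?thesis by (simp only: nu)
    qed
  qed
  also have "\<dots> = K * (4 * (r powr \<alpha> / (4 * r)))" using r by simp
  also have "\<dots> \<le> K * (4 * ((1 - (norm z)\<^sup>2) powr \<alpha> / (1 - (norm z)\<^sup>2)))"
  proof -
    have "r powr \<alpha> \<le> (1 - (norm z)\<^sup>2) powr \<alpha>"
      using r b(2) \<alpha> by (intro powr_mono2) (auto simp: r_def)
    moreover have "4 * r = 1 - (norm z)\<^sup>2" by (simp add: r_def)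
    ultimately have "r powr \<alpha> / (4 * r) \<le> (1 - (norm z)\<^sup>2) powr \<alpha> / (1 - (norm z)\<^sup>2)"
      using b(2) divide_right_mono[of "r powr \<alpha>" _ "1 - (norm z)\<^sup>2"] by simp
    then show ?thesis using K by (intro mult_left_mono) auto
  qed
  also have "\<dots> = 4 * K * (1 - (norm z)\<^sup>2) powr (\<alpha> - 1)"
    using b(2) by (simp add: powr_diff)
  finally show ?thesis .
qed

text \<open>
  With \<open>d = |z - w|\<close>, go from \<open>z\<close> radially to \<open>(1 - d) z\<close>, along a segment to \<open>(1 - d) w\<close>, and radially
  to \<open>w\<close>. On the radial pieces the bound on the derivative integrates to \<open>A / \<beta> * d powr \<beta>\<close>; on the
  segment, of length at most \<open>d\<close>, it is at most \<open>A * d powr (\<beta> - 1)\<close>. The constant \<open>C\<close> adds at most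
  \<open>C d\<close> on each of the three pieces. It is kept apart from \<open>A\<close> because its share is of smaller order
  when \<open>\<beta> < 1\<close>.
\<close>

lemma Hardy_Littlewood:
  fixes G :: "complex \<Rightarrow> 'a::complex_normed_vector"
  assumes \<beta>: "0 < \<beta>" "\<beta> \<le> 1" and A: "0 \<le> A" and C: "0 \<le> C"
    and cont: "continuous_on (cball 0 1) G"
    and der: "\<And>u. norm u < 1 \<Longrightarrow> \<exists>D. (G has_derivative (\<lambda>h. h *\<^sub>C D)) (at u) \<and>
       norm D \<le> A * (1 - (norm u)\<^sup>2) powr (\<beta> - 1) + C"
    and zw: "z \<in> cball 0 1" "w \<in> cball 0 1" "norm (z - w) \<le> 1"
  shows "norm (G z - G w) \<le> (1 + 2 / \<beta>) * A * norm (z - w) powr \<beta> + 3 * C * norm (z - w)"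
proof (cases "z = w")
  case False
  define d where "d = norm (z - w)"
  have d: "0 < d" "d \<le> 1" using False zw by (auto simp: d_def)
  obtain D where D: "\<And>u. norm u < 1 \<Longrightarrow> (G has_derivative (\<lambda>h. h *\<^sub>C D u)) (at u)"
    and D_le: "\<And>u. norm u < 1 \<Longrightarrow> norm (D u) \<le> A * (1 - (norm u)\<^sup>2) powr (\<beta> - 1) + C"
    using der by metis
  have powr_le: "(1 - (norm u)\<^sup>2) powr (\<beta> - 1) \<le> e powr (\<beta> - 1)"
    if "norm u \<le> 1 - e" "0 < e" for u :: complex and e
  proof (rule powr_mono2')
    have "(norm u)\<^sup>2 \<le> (1 - e) * 1" unfolding power2_eq_square
      using that order_trans[OF norm_ge_zero that(1)] by (intro mult_mono) auto
    then show "e \<le> 1 - (norm u)\<^sup>2" by simp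
  qed (use that \<beta> in auto)
  have radial: "norm (G u - G ((1 - d) *\<^sub>R u)) \<le> A / \<beta> * d powr \<beta> + C * d" if u: "u \<in> cball 0 1" for u
  proof -
    \<comment> \<open>A primitive of the bound for the derivative along the radius.\<close>
    define \<phi> where "\<phi> t = - (A / \<beta>) * (1 - t) powr \<beta> + C * t" for t
    have "norm (G (1 *\<^sub>R u) - G ((1 - d) *\<^sub>R u)) \<le> \<phi> 1 - \<phi> (1 - d)"
    proof (rule differentiable_bound_general)
      show "1 - d < 1" using d by simp
      show "continuous_on {1 - d..1} (\<lambda>t. G (t *\<^sub>R u))"
      proof (rule continuous_on_compose2[OF cont])
        show "(\<lambda>t. t *\<^sub>R u) ` {1 - d..1} \<subseteq> cball 0 1"
          using u d by (auto intro!: mult_le_one)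
      qed (intro continuous_intros)
      show "continuous_on {1 - d..1} \<phi>"
        unfolding \<phi>_def using \<beta> by (intro continuous_intros continuous_on_powr') auto
      fix t assume t: "1 - d < t" "t < 1"
      have tu: "norm (t *\<^sub>R u) \<le> t" using t u d by (simp add: mult_left_le)
      then have tu1: "norm (t *\<^sub>R u) < 1" using t by linarith
      have "((\<lambda>t. G (t *\<^sub>R u)) has_derivative (\<lambda>s. (s *\<^sub>R u) *\<^sub>C D (t *\<^sub>R u))) (at t)"
        using D[OF tu1] by (rule has_derivative_compose[rotated]) (auto intro!: derivative_eq_intros)
      moreover have "(s *\<^sub>R u) *\<^sub>C D (t *\<^sub>R u) = s *\<^sub>R (u *\<^sub>C D (t *\<^sub>R u))" for s
        by (metis scaleC_of_real scaleC_scaleC scaleR_conv_of_real)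
      ultimately show "((\<lambda>t. G (t *\<^sub>R u)) has_vector_derivative u *\<^sub>C D (t *\<^sub>R u)) (at t)"
        by (simp add: has_vector_derivative_def)
      show "(\<phi> has_vector_derivative A * (1 - t) powr (\<beta> - 1) + C) (at t)"
        unfolding \<phi>_def has_real_derivative_iff_has_vector_derivative[symmetric]
        using t \<beta> by (auto intro!: derivative_eq_intros simp: powr_diff field_simps)
      have "norm (u *\<^sub>C D (t *\<^sub>R u)) \<le> norm (D (t *\<^sub>R u))"
        using u by (simp add: norm_scaleC mult_left_le_one_le)
      also have "\<dots> \<le> A * (1 - (norm (t *\<^sub>R u))\<^sup>2) powr (\<beta> - 1) + C" by (rule D_le[OF tu1])
      also have "\<dots> \<le> A * (1 - t) powr (\<beta> - 1) + C"
        using tu t A by (intro add_right_mono mult_left_mono powr_le) auto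
      finally show "norm (u *\<^sub>C D (t *\<^sub>R u)) \<le> A * (1 - t) powr (\<beta> - 1) + C" .
    qed
    then show ?thesis by (simp add: \<phi>_def algebra_simps)
  qed
  have middle: "norm (G ((1 - d) *\<^sub>R z) - G ((1 - d) *\<^sub>R w)) \<le> A * d powr \<beta> + C * d"
  proof -
    have "norm (G ((1 - d) *\<^sub>R z) - G ((1 - d) *\<^sub>R w))
       \<le> (A * d powr (\<beta> - 1) + C) * norm ((1 - d) *\<^sub>R z - (1 - d) *\<^sub>R w)"
    proof (rule differentiable_bound[where S = "cball 0 (1 - d)" and f' = "\<lambda>u h. h *\<^sub>C D u"])
      fix u :: complex assume "u \<in> cball 0 (1 - d)"
      then have u: "norm u \<le> 1 - d" "norm u < 1" using d by auto
      show "(G has_derivative (\<lambda>h. h *\<^sub>C D u)) (at u within cball 0 (1 - d))"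
        by (rule has_derivative_at_withinI[OF D[OF u(2)]])
      have "norm (D u) \<le> A * d powr (\<beta> - 1) + C"
        using D_le[OF u(2)] mult_left_mono[OF powr_le[OF u(1) d(1)] A] by linarith
      then show "onorm (\<lambda>h. h *\<^sub>C D u) \<le> A * d powr (\<beta> - 1) + C"
        by (intro onorm_bound)
          (auto simp: norm_scaleC mult.commute[of "norm (D u)"] intro: order_trans[OF norm_ge_zero]
            intro!: mult_right_mono, metis mult.commute mult_right_mono norm_ge_zero)
    qed (use zw d in \<open>auto simp: mult_left_le\<close>)
    also have "\<dots> = (A * d powr (\<beta> - 1) + C) * ((1 - d) * d)"
      using d by (simp add: d_def flip: scaleR_diff_right)
    also have "\<dots> \<le> (A * d powr (\<beta> - 1) + C) * d"
      using A C d by (intro mult_left_mono) (auto simp: mult_le_cancel_right1)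
    also have "\<dots> = A * d powr \<beta> + C * d"
      using d by (simp add: powr_diff field_simps)
    finally show ?thesis .
  qed
  have "norm (G z - G w) \<le> norm (G z - G ((1 - d) *\<^sub>R z)) +
      norm (G ((1 - d) *\<^sub>R z) - G ((1 - d) *\<^sub>R w)) + norm (G w - G ((1 - d) *\<^sub>R w))"
    by norm
  also have "\<dots> \<le> (A / \<beta> * d powr \<beta> + C * d) + (A * d powr \<beta> + C * d) + (A / \<beta> * d powr \<beta> + C * d)"
    by (intro add_mono radial middle zw)
  also have "\<dots> = (1 + 2 / \<beta>) * A * d powr \<beta> + 3 * C * d"
    using \<beta> by (simp add: field_simps)
  finally show ?thesis by (simp add: d_def)
qed simp

text \<open>
  Letting the radius tend to 0 in Cauchy's estimate shows that the derivative vanishes.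
\<close>

lemma lip_A_one_constant:
  assumes f: "f \<in> lip_A S 1" and zw: "z \<in> cball 0 1" "w \<in> cball 0 1"
  shows "f z = f w"
proof -
  have fd: "f \<in> disk_algebra S" and u: "uniformly_lip 1 {f}"
    using f by (auto simp: lip_A_iff Lip_A_def)
  have D: "(f has_derivative (\<lambda>h. 0)) (at x)" if x: "norm x < 1" for x
  proof -
    obtain D where D: "(f has_derivative (\<lambda>h. h *\<^sub>C D)) (at x)"
      using disk_algebra_derivative[OF fd x] by blast
    have "norm D \<le> 0 + \<epsilon>" if \<epsilon>: "0 < \<epsilon>" for \<epsilon>
    proof -
      obtain \<delta> where \<delta>: "0 < \<delta>" "\<And>g z w. g \<in> {f} \<Longrightarrow> z \<in> cball 0 1 \<Longrightarrow> w \<in> cball 0 1 \<Longrightarrow>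
         norm (z - w) < \<delta> \<Longrightarrow> norm (g z - g w) \<le> \<epsilon> * norm (z - w) powr 1"
        by (rule uniformly_lipD[OF u \<epsilon>]) blast
      define R where "R = min ((1 - (norm x)\<^sup>2) / 2) \<delta>"
      have R: "0 < R" using ball_subset_unit_ball(2)[OF x] \<delta> by (auto simp: R_def)
      have sub: "norm y < 1" if "y \<in> ball x R" for y
        using ball_subset_unit_ball(1)[OF x] that by (auto simp: R_def)
      have "norm D \<le> (\<epsilon> * (R / 2)) / (R / 2)"
      proof (rule Cauchy_estimate[where F = f and z = x and R = R and c = "f x"])
        show "\<exists>d. (f has_derivative (\<lambda>h. h *\<^sub>C d)) (at y)" if "y \<in> ball x R" for y
          using disk_algebra_derivative[OF fd sub[OF that]] by blast
        show "norm (f y - f x) \<le> \<epsilon> * (R / 2)" if "dist x y = R / 2" for y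
        proof -
          have *: "norm (y - x) = R / 2" using that by (simp add: dist_norm norm_minus_commute)
          have "norm y < 1" using sub[of y] that R by simp
          moreover have "R / 2 < \<delta>" using R by (auto simp: R_def)
          ultimately show ?thesis using \<delta>(2)[of f y x] x * R by simp
        qed
      qed (use D R in auto)
      then show ?thesis using R by simp
    qed
    then have "norm D \<le> 0" by (rule field_le_epsilon)
    then have "D = 0" by simp
    with D show ?thesis by (simp add: scaleC_zero_right)
  qed
  have *: "\<exists>D. (f has_derivative (\<lambda>h. h *\<^sub>C D)) (at u) \<and>
       norm D \<le> 0 * (1 - (norm u)\<^sup>2) powr (1 - 1) + 0" if "norm u < 1" for u
    using D[OF that] by (intro exI[of _ 0]) (simp add: scaleC_zero_right)
  have cont: "continuous_on (cball 0 1) f" using fd by (simp add: disk_algebra_def)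
  have "f x = f 0" if "x \<in> cball 0 1" for x
    using Hardy_Littlewood[OF _ _ _ _ cont *, of x 0] that by simp
  then show ?thesis using zw by metis
qed

lemma linear_le_powr:
  fixes L \<alpha> \<epsilon> :: real
  assumes "0 \<le> L" "\<alpha> < 1" "0 < \<epsilon>"
  shows "\<exists>\<delta>>0. \<forall>t. 0 \<le> t \<and> t < \<delta> \<longrightarrow> L * t \<le> \<epsilon> * t powr \<alpha>"
proof (intro exI conjI allI impI)
  define \<delta> where "\<delta> = (\<epsilon> / (L + 1)) powr (1 / (1 - \<alpha>))"
  show "0 < \<delta>" using assms by (simp add: \<delta>_def)
  fix t assume t: "0 \<le> t \<and> t < \<delta>"
  show "L * t \<le> \<epsilon> * t powr \<alpha>"
  proof (cases "t = 0")
    case False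
    have "t powr (1 - \<alpha>) \<le> \<delta> powr (1 - \<alpha>)"
      using t assms by (intro powr_mono2) auto
    also have "\<dots> = \<epsilon> / (L + 1)" using assms by (simp add: \<delta>_def powr_powr)
    finally have *: "(L + 1) * t powr (1 - \<alpha>) \<le> \<epsilon>" using assms by (simp add: field_simps)
    have "L * t \<le> (L + 1) * t" using t by (intro mult_right_mono) auto
    also have "\<dots> = (L + 1) * t powr (1 - \<alpha>) * t powr \<alpha>"
      using t False by (simp flip: powr_add)
    also have "\<dots> \<le> \<epsilon> * t powr \<alpha>" using * by (intro mult_right_mono) auto
    finally show ?thesis .
  qed simp
qed

lemma lip_A_Lipschitz:
  assumes f: "f \<in> disk_algebra S" and \<alpha>: "\<alpha> < 1" and L: "0 \<le> L"
    and le: "\<And>z w. z \<in> cball 0 1 \<Longrightarrow> w \<in> cball 0 1 \<Longrightarrow> norm (f z - f w) \<le> K * norm (z - w) powr \<alpha>"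
    and Lip: "\<And>z w. z \<in> cball 0 1 \<Longrightarrow> w \<in> cball 0 1 \<Longrightarrow> norm (f z - f w) \<le> L * norm (z - w)"
  shows "f \<in> lip_A S \<alpha>"
proof -
  have "uniformly_lip \<alpha> {f}"
    unfolding uniformly_lip_def
  proof (intro allI impI)
    fix \<epsilon> :: real assume \<epsilon>: "0 < \<epsilon>"
    obtain \<delta> where \<delta>: "0 < \<delta>" "\<forall>t. 0 \<le> t \<and> t < \<delta> \<longrightarrow> L * t \<le> \<epsilon> * t powr \<alpha>"
      using linear_le_powr[OF L \<alpha> \<epsilon>] by blast
    have "norm (f z - f w) \<le> \<epsilon> * norm (z - w) powr \<alpha>"
      if "z \<in> cball 0 1" "w \<in> cball 0 1" "norm (z - w) < \<delta>" for z w
      using order_trans[OF Lip[OF that(1,2)]] \<delta>(2) that(3) by simp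
    then show "\<exists>\<delta>>0. \<forall>f\<in>{f}. \<forall>z\<in>cball 0 1. \<forall>w\<in>cball 0 1.
        norm (z - w) < \<delta> \<longrightarrow> norm (f z - f w) \<le> \<epsilon> * norm (z - w) powr \<alpha>"
      using \<delta>(1) by (intro exI[of _ \<delta>]) auto
  qed
  moreover have "bdd_above (Lip_quotients \<alpha> f)" by (rule Lip_quotients_le(2)[OF le])
  ultimately show ?thesis using f by (simp add: lip_A_iff Lip_A_def)
qed

section \<open>Compact operators\<close>

lemma compact_closureI:
  fixes S :: "'a::t2_space set"
  assumes "compact K" "S \<subseteq> K"
  shows "compact (closure S)"
proof -
  have "closure S \<subseteq> K" using assms by (intro closure_minimal compact_imp_closed)
  then have "closure S = closure S \<inter> K" by blast
  then show ?thesis using assms(1) by (metis closed_closure closed_Int_compact)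
qed

lemma compact_closure_iff_totally_bounded:
  fixes S :: "'a::banach set"
  shows "compact (closure S) \<longleftrightarrow> (\<forall>\<epsilon>>0. \<exists>k. finite k \<and> S \<subseteq> (\<Union>x\<in>k. ball x \<epsilon>))"
proof
  assume "compact (closure S)"
  then show "\<forall>\<epsilon>>0. \<exists>k. finite k \<and> S \<subseteq> (\<Union>x\<in>k. ball x \<epsilon>)"
    unfolding compact_eq_totally_bounded using closure_subset by (meson order_trans)
next
  assume *: "\<forall>\<epsilon>>0. \<exists>k. finite k \<and> S \<subseteq> (\<Union>x\<in>k. ball x \<epsilon>)"
  show "compact (closure S)"
    unfolding compact_eq_totally_bounded
  proof (intro conjI allI impI)
    show "complete (closure S)" by (simp add: complete_eq_closed)
    fix \<epsilon> :: real assume "0 < \<epsilon>"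
    then obtain k where k: "finite k" "S \<subseteq> (\<Union>x\<in>k. ball x (\<epsilon> / 2))"
      using * half_gt_zero by blast
    have "S \<subseteq> (\<Union>x\<in>k. cball x (\<epsilon> / 2))" using k(2) ball_subset_cball by blast
    then have "closure S \<subseteq> (\<Union>x\<in>k. cball x (\<epsilon> / 2))"
      using k(1) by (intro closure_minimal closed_UN) auto
    also have "\<dots> \<subseteq> (\<Union>x\<in>k. ball x \<epsilon>)" using \<open>0 < \<epsilon>\<close> by force
    finally show "\<exists>k. finite k \<and> closure S \<subseteq> (\<Union>x\<in>k. ball x \<epsilon>)" using k(1) by blast
  qed
qed

lemma compact_ops_diff:
  assumes "S \<in> compact_ops" "T \<in> compact_ops"
  shows "S - T \<in> compact_ops"
proof -
  let ?S = "closure (blinfun_apply S ` cball 0 1)" and ?T = "closure (blinfun_apply T ` cball 0 1)"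
  have "compact ((\<lambda>(x, y). x - y) ` (?S \<times> ?T))"
    using assms
    by (intro compact_continuous_image compact_Times)
      (auto simp: compact_ops_def case_prod_beta intro!: continuous_intros)
  moreover have "blinfun_apply (S - T) ` cball 0 1 \<subseteq> (\<lambda>(x, y). x - y) ` (?S \<times> ?T)"
  proof
    fix y assume "y \<in> blinfun_apply (S - T) ` cball 0 1"
    then obtain x where x: "x \<in> cball 0 1" "y = S x - T x" by (auto simp: blinfun.diff_left)
    then have "S x \<in> ?S" "T x \<in> ?T" by (meson closure_subset image_eqI subsetD)+
    then show "y \<in> (\<lambda>(x, y). x - y) ` (?S \<times> ?T)" unfolding x(2) by force
  qed
  ultimately have "compact (closure (blinfun_apply (S - T) ` cball 0 1))"
    by (rule compact_closureI)
  then show ?thesis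
    using assms by (simp add: compact_ops_def bounded_ops_def blinfun.diff_left scaleC_diff_right)
qed

lemma compact_ops_scaleC:
  assumes "T \<in> compact_ops"
  shows "a *\<^sub>C T \<in> compact_ops"
proof -
  have "compact ((\<lambda>y. a *\<^sub>C y) ` closure (blinfun_apply T ` cball 0 1))"
    using assms
    by (intro compact_continuous_image linear_continuous_on bounded_linear_scaleC_right)
      (auto simp: compact_ops_def)
  moreover have "blinfun_apply (a *\<^sub>C T) ` cball 0 1 \<subseteq> (\<lambda>y. a *\<^sub>C y) ` closure (blinfun_apply T ` cball 0 1)"
    using closure_subset by (fastforce simp: scaleC_blinfun_apply)
  ultimately have "compact (closure (blinfun_apply (a *\<^sub>C T) ` cball 0 1))"
    by (rule compact_closureI)
  then show ?thesis
    using assms by (simp add: compact_ops_def bounded_ops_def scaleC_blinfun_apply scaleC_scaleC mult.commute)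
qed

text \<open>
  Approximate \<open>T\<close> up to \<open>\<epsilon> / 2\<close> in norm by a compact operator; an \<open>\<epsilon> / 2\<close>-net for the image of its unit
  ball is an \<open>\<epsilon>\<close>-net for that of \<open>T\<close>.
\<close>

lemma compact_ops_closed:
  fixes T :: "'a::complex_normed_vector \<Rightarrow>\<^sub>L 'b::{complex_normed_vector, banach}"
  assumes T: "T \<in> bounded_ops" and approx: "\<And>\<epsilon>. 0 < \<epsilon> \<Longrightarrow> \<exists>U\<in>compact_ops. norm (U - T) \<le> \<epsilon>"
  shows "T \<in> compact_ops"
proof -
  have "\<exists>k. finite k \<and> blinfun_apply T ` cball 0 1 \<subseteq> (\<Union>y\<in>k. ball y \<epsilon>)" if \<epsilon>: "0 < \<epsilon>" for \<epsilon>
  proof -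
    obtain U where U: "U \<in> compact_ops" "norm (U - T) \<le> \<epsilon> / 2" using approx[of "\<epsilon> / 2"] \<epsilon> by auto
    obtain k where k: "finite k" "blinfun_apply U ` cball 0 1 \<subseteq> (\<Union>y\<in>k. ball y (\<epsilon> / 2))"
      using U(1) \<epsilon> half_gt_zero unfolding compact_ops_def compact_closure_iff_totally_bounded by blast
    have "blinfun_apply T x \<in> (\<Union>y\<in>k. ball y \<epsilon>)" if x: "norm x \<le> 1" for x
    proof -
      obtain y where y: "y \<in> k" "dist y (U x) < \<epsilon> / 2" using k(2) x by fastforce
      have "norm ((U - T) x) \<le> norm (U - T) * norm x" by (rule norm_blinfun)
      also have "\<dots> \<le> \<epsilon> / 2 * 1" using U(2) x \<epsilon> by (intro mult_mono) auto
      finally have "dist (U x) (T x) \<le> \<epsilon> / 2" by (simp add: dist_norm blinfun.diff_left)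
      with y(2) have "dist y (T x) < \<epsilon>" using dist_triangle[of y "T x" "U x"] by linarith
      with y(1) show ?thesis by auto
    qed
    then show ?thesis using k(1) by auto
  qed
  then have "compact (closure (blinfun_apply T ` cball 0 1))"
    unfolding compact_closure_iff_totally_bounded by blast
  then show ?thesis using T by (simp add: compact_ops_def)
qed

text \<open>
  The derivative is the limit of difference quotients, and the compact operators form a closed
  subspace.
\<close>

lemma compact_ops_derivative:
  fixes F :: "complex \<Rightarrow> 'a::complex_normed_vector \<Rightarrow>\<^sub>L 'b::{complex_normed_vector, banach}"
  assumes F: "(F has_derivative (\<lambda>h. h *\<^sub>C D)) (at z)" and D: "D \<in> bounded_ops"
    and ev: "eventually (\<lambda>u. F u \<in> compact_ops) (nhds z)"
  shows "D \<in> compact_ops"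
proof (rule compact_ops_closed[OF D])
  fix \<epsilon> :: real assume \<epsilon>: "0 < \<epsilon>"
  obtain e where e: "0 < e" "\<forall>u. dist u z < e \<longrightarrow> F u \<in> compact_ops"
    using ev unfolding eventually_nhds_metric by auto
  have "\<exists>d>0. \<forall>u. norm (u - z) < d \<longrightarrow> norm (F u - F z - (u - z) *\<^sub>C D) \<le> \<epsilon> * norm (u - z)"
    using F \<epsilon> unfolding has_derivative_at_alt by simp
  then obtain d where d: "0 < d" "\<forall>u. norm (u - z) < d \<longrightarrow> norm (F u - F z - (u - z) *\<^sub>C D) \<le> \<epsilon> * norm (u - z)"
    by auto
  define h where "h = complex_of_real (min d e / 2)"
  have h: "h \<noteq> 0" "norm h < d" "norm h < e" using d e by (auto simp: h_def)
  define U where "U = inverse h *\<^sub>C (F (z + h) - F z)"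
  have "U \<in> compact_ops"
    unfolding U_def using e h by (intro compact_ops_scaleC compact_ops_diff e(2)[rule_format]) (auto simp: dist_norm)
  moreover have "norm (U - D) \<le> \<epsilon>"
  proof -
    have "inverse h *\<^sub>C h *\<^sub>C D = D" using h(1) by (simp add: scaleC_scaleC scaleC_one)
    then have "U - D = inverse h *\<^sub>C (F (z + h) - F z - h *\<^sub>C D)"
      by (simp add: U_def scaleC_diff_right)
    then have "norm (U - D) = inverse (norm h) * norm (F (z + h) - F z - h *\<^sub>C D)"
      by (simp add: norm_scaleC norm_inverse)
    also have "\<dots> \<le> inverse (norm h) * (\<epsilon> * norm h)"
      using d(2)[rule_format, of "z + h"] h(2) by (intro mult_left_mono) auto
    also have "\<dots> = \<epsilon>" using h(1) by (simp add: field_simps)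
    finally show ?thesis .
  qed
  ultimately show "\<exists>U\<in>compact_ops. norm (U - D) \<le> \<epsilon>" by blast
qed

section \<open>Relative compactness in the little Lipschitz space\<close>

lemma Lip_dist_le:
  assumes "f \<in> lip_A UNIV \<alpha>" "g \<in> lip_A UNIV \<alpha>"
    and "\<And>z. z \<in> cball 0 1 \<Longrightarrow> norm (f z - g z) \<le> a"
    and "\<And>z w. z \<in> cball 0 1 \<Longrightarrow> w \<in> cball 0 1 \<Longrightarrow>
       norm ((f z - f w) - (g z - g w)) \<le> b * norm (z - w) powr \<alpha>"
  shows "Lip_dist \<alpha> f g \<le> a + b"
proof -
  have eq: "(f z - g z) - (f w - g w) = (f z - f w) - (g z - g w)" for z w by simp
  have "Lip_norm \<alpha> (\<lambda>z. f z - g z) \<le> a + b"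
  proof (rule Lip_norm_le[OF assms(3)])
    show "norm ((f z - g z) - (f w - g w)) \<le> b * norm (z - w) powr \<alpha>"
      if "z \<in> cball 0 1" "w \<in> cball 0 1" for z w
      unfolding eq by (rule assms(4)[OF that])
  qed
  then show ?thesis using assms by (simp add: Lip_dist_def)
qed

lemma le_Lip_dist:
  assumes "f \<in> lip_A UNIV \<alpha>" "g \<in> lip_A UNIV \<alpha>" "z \<in> cball 0 1"
  shows "norm (f z - g z) \<le> Lip_dist \<alpha> f g"
    and "w \<in> cball 0 1 \<Longrightarrow> norm ((f z - f w) - (g z - g w)) \<le> Lip_dist \<alpha> f g * norm (z - w) powr \<alpha>"
proof -
  have *: "(\<lambda>z. f z - g z) \<in> Lip_A UNIV \<alpha>"
    using assms by (intro Lip_A_diff) (auto simp: lip_A_def)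
  show "norm (f z - g z) \<le> Lip_dist \<alpha> f g"
    using norm_le_Lip_norm[OF * assms(3)] assms by (simp add: Lip_dist_def)
  have eq: "(f z - f w) - (g z - g w) = (f z - g z) - (f w - g w)" by simp
  show "w \<in> cball 0 1 \<Longrightarrow> norm ((f z - f w) - (g z - g w)) \<le> Lip_dist \<alpha> f g * norm (z - w) powr \<alpha>"
    unfolding eq using Lip_A_le[OF * assms(3), of w] assms by (simp add: Lip_dist_def)
qed

text \<open>
  Each member of a finite \<open>\<epsilon> / 2\<close>-net has its own \<open>\<delta>\<close>; the least of these serves all members of
  \<open>M\<close>.
\<close>

lemma uniformly_lip_totally_bounded:
  assumes "Metric_space.mtotally_bounded (lip_A UNIV \<alpha>) (Lip_dist \<alpha>) M"
  shows "uniformly_lip \<alpha> M"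
  unfolding uniformly_lip_def
proof (intro allI impI)
  interpret Metric_space "lip_A UNIV \<alpha>" "Lip_dist \<alpha> :: (complex \<Rightarrow> 'a) \<Rightarrow> _" by (rule Metric_space_lip_A)
  have M_lip: "M \<subseteq> lip_A UNIV \<alpha>" by (rule mtotally_bounded_imp_subset[OF assms])
  fix \<epsilon> :: real assume \<epsilon>: "0 < \<epsilon>"
  then obtain N where N: "finite N" "N \<subseteq> M" "M \<subseteq> (\<Union>g\<in>N. mball g (\<epsilon> / 2))"
    using assms half_gt_zero unfolding mtotally_bounded_def by meson
  have "\<forall>g\<in>N. \<exists>\<delta>>0. \<forall>z\<in>cball 0 1. \<forall>w\<in>cball 0 1.
      norm (z - w) < \<delta> \<longrightarrow> norm (g z - g w) \<le> \<epsilon> / 2 * norm (z - w) powr \<alpha>"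
  proof
    fix g assume "g \<in> N"
    then have "g \<in> lip_A UNIV \<alpha>" using N(2) M_lip by auto
    then have "uniformly_lip \<alpha> {g}" by (simp add: lip_A_iff)
    then have "\<forall>\<epsilon>>0. \<exists>\<delta>>0. \<forall>z\<in>cball 0 1. \<forall>w\<in>cball 0 1.
      norm (z - w) < \<delta> \<longrightarrow> norm (g z - g w) \<le> \<epsilon> * norm (z - w) powr \<alpha>"
      by (simp add: uniformly_lip_def)
    from this[rule_format, OF half_gt_zero[OF \<epsilon>]]
    show "\<exists>\<delta>>0. \<forall>z\<in>cball 0 1. \<forall>w\<in>cball 0 1.
      norm (z - w) < \<delta> \<longrightarrow> norm (g z - g w) \<le> \<epsilon> / 2 * norm (z - w) powr \<alpha>" .
  qed
  from bchoice[OF this] obtain \<delta> where \<delta>: "\<forall>g\<in>N. 0 < \<delta> g \<and> (\<forall>z\<in>cball 0 1. \<forall>w\<in>cball 0 1.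
      norm (z - w) < \<delta> g \<longrightarrow> norm (g z - g w) \<le> \<epsilon> / 2 * norm (z - w) powr \<alpha>)" ..
  define d where "d = Min (insert 1 (\<delta> ` N))"
  have "0 < d" using N(1) \<delta> by (auto simp: d_def)
  moreover have "norm (f z - f w) \<le> \<epsilon> * norm (z - w) powr \<alpha>"
    if f: "f \<in> M" and zw: "z \<in> cball 0 1" "w \<in> cball 0 1" "norm (z - w) < d" for f z w
  proof -
    obtain g where g: "g \<in> N" "Lip_dist \<alpha> g f < \<epsilon> / 2" using N(3) f by force
    have gf: "g \<in> lip_A UNIV \<alpha>" "f \<in> lip_A UNIV \<alpha>" using N(2) M_lip g(1) f by auto
    have "d \<le> \<delta> g" unfolding d_def using N(1) g(1) by (intro Min_le) auto
    then have 1: "norm (g z - g w) \<le> \<epsilon> / 2 * norm (z - w) powr \<alpha>"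
      using zw g(1) \<delta> by auto
    have "norm ((g z - g w) - (f z - f w)) \<le> Lip_dist \<alpha> g f * norm (z - w) powr \<alpha>"
      by (rule le_Lip_dist(2)[OF gf zw(1,2)])
    also have "\<dots> \<le> \<epsilon> / 2 * norm (z - w) powr \<alpha>" using g(2) by (intro mult_right_mono) auto
    finally show ?thesis using 1 norm_triangle_sub[of "f z - f w" "g z - g w"]
      by (simp add: norm_minus_commute)
  qed
  ultimately show "\<exists>\<delta>>0. \<forall>f\<in>M. \<forall>z\<in>cball 0 1. \<forall>w\<in>cball 0 1.
      norm (z - w) < \<delta> \<longrightarrow> norm (f z - f w) \<le> \<epsilon> * norm (z - w) powr \<alpha>"
    by (intro exI[of _ d]) auto
qed

lemma pointwise_totally_bounded:
  assumes M: "Metric_space.mtotally_bounded (lip_A UNIV \<alpha>) (Lip_dist \<alpha>) M"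
    and z: "z \<in> cball 0 1" and \<epsilon>: "0 < \<epsilon>"
  shows "\<exists>k. finite k \<and> (\<lambda>f. f z) ` M \<subseteq> (\<Union>x\<in>k. ball x \<epsilon>)"
proof -
  interpret Metric_space "lip_A UNIV \<alpha>" "Lip_dist \<alpha> :: (complex \<Rightarrow> 'a) \<Rightarrow> _" by (rule Metric_space_lip_A)
  obtain N where N: "finite N" "M \<subseteq> (\<Union>g\<in>N. mball g \<epsilon>)"
    using M \<epsilon> unfolding mtotally_bounded_def by meson
  have "f z \<in> (\<Union>x\<in>(\<lambda>g. g z) ` N. ball x \<epsilon>)" if f: "f \<in> M" for f
  proof -
    obtain g where g: "g \<in> N" "g \<in> lip_A UNIV \<alpha>" "f \<in> lip_A UNIV \<alpha>" "Lip_dist \<alpha> g f < \<epsilon>"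
      using N(2) f by (force simp: mball_def)
    have "g z \<in> (\<lambda>g. g z) ` N" using g(1) by blast
    moreover have "f z \<in> ball (g z) \<epsilon>" using le_Lip_dist(1)[OF g(2,3) z] g(4) by (simp add: dist_norm)
    ultimately show ?thesis by blast
  qed
  then show ?thesis using N(1) by blast
qed

text \<open>
  Record for each \<open>f\<close> and each \<open>z\<close> which ball of a finite net contains \<open>f z\<close>. Only finitely many such
  records occur, and functions with the same record are close on \<open>Z\<close>.
\<close>

lemma finite_representatives:
  fixes M :: "('a \<Rightarrow> 'b::metric_space) set"
  assumes Z: "finite Z" and \<tau>: "0 < \<tau>"
    and tb: "\<And>z \<epsilon>. z \<in> Z \<Longrightarrow> 0 < \<epsilon> \<Longrightarrow> \<exists>k. finite k \<and> (\<lambda>f. f z) ` M \<subseteq> (\<Union>x\<in>k. ball x \<epsilon>)"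
  shows "\<exists>N\<subseteq>M. finite N \<and> (\<forall>f\<in>M. \<exists>g\<in>N. \<forall>z\<in>Z. dist (g z) (f z) < \<tau>)"
proof -
  have "\<forall>z\<in>Z. \<exists>k. finite k \<and> (\<lambda>f. f z) ` M \<subseteq> (\<Union>x\<in>k. ball x (\<tau> / 2))"
    using tb \<tau> by simp
  then obtain K where K: "\<And>z. z \<in> Z \<Longrightarrow> finite (K z)"
    "\<And>z. z \<in> Z \<Longrightarrow> (\<lambda>f. f z) ` M \<subseteq> (\<Union>x\<in>K z. ball x (\<tau> / 2))"
    by metis
  have "\<forall>z\<in>Z. \<forall>f\<in>M. \<exists>x. x \<in> K z \<and> dist x (f z) < \<tau> / 2"
    using K(2) by fastforce
  then obtain c where c: "\<And>z f. z \<in> Z \<Longrightarrow> f \<in> M \<Longrightarrow> c z f \<in> K z \<and> dist (c z f) (f z) < \<tau> / 2"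
    by metis
  define code where "code f = restrict (\<lambda>z. c z f) Z" for f
  have "code ` M \<subseteq> PiE Z K" using c by (auto simp: code_def)
  then have "finite (code ` M)" using finite_PiE[OF Z] K(1) finite_subset by metis
  then obtain N where N: "N \<subseteq> M" "finite N" "code ` M = code ` N"
    using finite_subset_image[of "code ` M" code M] by blast
  have "\<exists>g\<in>N. \<forall>z\<in>Z. dist (g z) (f z) < \<tau>" if f: "f \<in> M" for f
  proof -
    obtain g where g: "g \<in> N" "code g = code f" using N(3) f by (metis imageE imageI)
    have "dist (g z) (f z) < \<tau>" if z: "z \<in> Z" for z
    proof -
      have "c z g = c z f" using g(2) z by (metis code_def restrict_apply')
      then show ?thesis
        using c[OF z f] c[OF z, of g] g(1) N(1) dist_triangle_half_r[of "c z f" "g z" \<tau> "f z"] by auto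
    qed
    then show ?thesis using g(1) by blast
  qed
  with N(1,2) show ?thesis by blast
qed

text \<open>
  At distances below \<open>\<delta>\<close> the Lipschitz quotient of a difference of two members is small by the uniform
  condition. At larger distances it is controlled by the sup norm of the difference, which in turn is
  controlled by the values on a finite \<open>\<delta>\<close>-net of the disk.
\<close>

lemma totally_bounded_uniformly_lip:
  assumes \<alpha>: "0 < \<alpha>" and M_lip: "M \<subseteq> lip_A UNIV \<alpha>" and u: "uniformly_lip \<alpha> M"
    and tb: "\<And>z \<epsilon>. z \<in> cball 0 1 \<Longrightarrow> 0 < \<epsilon> \<Longrightarrow> \<exists>k. finite k \<and> (\<lambda>f. f z) ` M \<subseteq> (\<Union>x\<in>k. ball x \<epsilon>)"
  shows "Metric_space.mtotally_bounded (lip_A UNIV \<alpha>) (Lip_dist \<alpha>) M"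
proof -
  interpret Metric_space "lip_A UNIV \<alpha>" "Lip_dist \<alpha> :: (complex \<Rightarrow> 'a) \<Rightarrow> _" by (rule Metric_space_lip_A)
  show ?thesis
    unfolding mtotally_bounded_def
  proof (intro allI impI)
    fix \<epsilon> :: real assume \<epsilon>: "0 < \<epsilon>"
    \<comment> \<open>The sup norm costs 3 e and the Lipschitz quotient 6 e, hence a tenth.\<close>
    define e where "e = \<epsilon> / 10"
    have e: "0 < e" using \<epsilon> by (simp add: e_def)
    obtain \<delta>0 where \<delta>0: "0 < \<delta>0" "\<And>f z w. f \<in> M \<Longrightarrow> z \<in> cball 0 1 \<Longrightarrow> w \<in> cball 0 1 \<Longrightarrow>
       norm (z - w) < \<delta>0 \<Longrightarrow> norm (f z - f w) \<le> e * norm (z - w) powr \<alpha>"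
      by (rule uniformly_lipD[OF u e]) blast
    \<comment> \<open>Radius at most 1, so that \<open>\<tau> \<le> e\<close> below.\<close>
    define \<delta> where "\<delta> = min \<delta>0 1"
    have \<delta>: "0 < \<delta>" "\<delta> \<le> 1" using \<delta>0 by (auto simp: \<delta>_def)
    have lip: "norm (f z - f w) \<le> e * norm (z - w) powr \<alpha>"
      if "f \<in> M" "z \<in> cball 0 1" "w \<in> cball 0 1" "norm (z - w) < \<delta>" for f z w
      using that by (intro \<delta>0(2)) (auto simp: \<delta>_def)
    \<comment> \<open>The accuracy at the net points: the largest oscillation allowed at distance \<open>\<delta>\<close>.\<close>
    define \<tau> where "\<tau> = e * \<delta> powr \<alpha>"
    have \<tau>: "0 < \<tau>" "\<tau> \<le> e"
      using e \<delta> \<alpha> powr_le1[of \<alpha> \<delta>] by (auto simp: \<tau>_def intro: mult_left_le)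
    obtain Z where Z: "finite Z" "Z \<subseteq> cball 0 1" "cball (0::complex) 1 \<subseteq> (\<Union>z\<in>Z. ball z \<delta>)"
      using seq_compact_imp_totally_bounded[of "cball (0::complex) 1"] \<delta>(1)
      by (auto simp: compact_imp_seq_compact)
    have "\<exists>N\<subseteq>M. finite N \<and> (\<forall>f\<in>M. \<exists>g\<in>N. \<forall>z\<in>Z. dist (g z) (f z) < \<tau>)"
      using Z(2) by (intro finite_representatives[OF Z(1) \<tau>(1)] tb) auto
    then obtain N where N: "finite N" "N \<subseteq> M" "\<forall>f\<in>M. \<exists>g\<in>N. \<forall>z\<in>Z. dist (g z) (f z) < \<tau>"
      by blast
    have "f \<in> (\<Union>g\<in>N. mball g \<epsilon>)" if f: "f \<in> M" for f
    proof -
      obtain g where g: "g \<in> N" "\<And>z. z \<in> Z \<Longrightarrow> dist (g z) (f z) < \<tau>" using N(3) f by meson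
      have gM: "g \<in> M" using g(1) N(2) by blast
      have sup: "norm (g z - f z) \<le> 3 * \<tau>" if z: "z \<in> cball 0 1" for z
      proof -
        obtain v where v: "v \<in> Z" "norm (z - v) < \<delta>"
          using Z(3) z by (fastforce simp: dist_norm norm_minus_commute)
        have small: "norm (h z - h v) \<le> \<tau>" if "h \<in> M" for h
        proof -
          have "norm (h z - h v) \<le> e * norm (z - v) powr \<alpha>" using lip[OF that z _ v(2)] v(1) Z(2) by blast
          also have "\<dots> \<le> \<tau>" unfolding \<tau>_def using v(2) e \<alpha> by (intro mult_left_mono powr_mono2) auto
          finally show ?thesis .
        qed
        have "norm (g v - f v) < \<tau>" using g(2)[OF v(1)] by (simp add: dist_norm)
        moreover have "norm (g z - f z) \<le> norm (g z - g v) + norm (g v - f v) + norm (f z - f v)"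
          by norm
        ultimately show ?thesis using small[OF gM] small[OF f] by linarith
      qed
      have "Lip_dist \<alpha> g f \<le> 3 * e + 6 * e"
      proof (rule Lip_dist_le)
        show "g \<in> lip_A UNIV \<alpha>" "f \<in> lip_A UNIV \<alpha>" using gM f M_lip by auto
        show "norm (g z - f z) \<le> 3 * e" if "z \<in> cball 0 1" for z using sup[OF that] \<tau>(2) by linarith
        show "norm ((g z - g w) - (f z - f w)) \<le> 6 * e * norm (z - w) powr \<alpha>"
          if zw: "z \<in> cball 0 1" "w \<in> cball 0 1" for z w
        proof (cases "norm (z - w) < \<delta>")
          case True
          have "0 \<le> e * norm (z - w) powr \<alpha>" using e by simp
          then show ?thesis
            using lip[OF gM zw True] lip[OF f zw True] norm_triangle_ineq4[of "g z - g w" "f z - f w"]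
            by linarith
        next
          case False
          have "norm ((g z - g w) - (f z - f w)) \<le> norm (g z - f z) + norm (g w - f w)"
            by norm
          also have "\<dots> \<le> 6 * e * \<delta> powr \<alpha>" using sup[OF zw(1)] sup[OF zw(2)] by (simp add: \<tau>_def)
          also have "\<dots> \<le> 6 * e * norm (z - w) powr \<alpha>"
            using False e \<alpha> \<delta> by (intro mult_left_mono powr_mono2) auto
          finally show ?thesis .
        qed
      qed
      also have "\<dots> < \<epsilon>" using \<epsilon> by (simp add: e_def)
      finally show ?thesis using g(1) gM f M_lip by auto
    qed
    then show "\<exists>K. finite K \<and> K \<subseteq> M \<and> M \<subseteq> (\<Union>x\<in>K. mball x \<epsilon>)"
      using N(1,2) by blast
  qed
qed

text \<open>
  By Cauchy's estimate for differences the derivatives form a uniform Cauchy sequence on a smaller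
  disk, so the theorem on differentiation of limits applies.
\<close>

lemma uniform_limit_complex_differentiable:
  fixes F :: "nat \<Rightarrow> complex \<Rightarrow> 'a::{complex_normed_vector, banach}"
  assumes R: "0 < R"
    and der: "\<And>n u. u \<in> ball z R \<Longrightarrow> \<exists>d. (F n has_derivative (\<lambda>h. h *\<^sub>C d)) (at u)"
    and cau: "\<And>\<epsilon>. 0 < \<epsilon> \<Longrightarrow> \<exists>N. \<forall>m\<ge>N. \<forall>n\<ge>N. \<forall>u\<in>ball z R. norm (F m u - F n u) \<le> \<epsilon>"
    and lim: "\<And>u. u \<in> ball z R \<Longrightarrow> (\<lambda>n. F n u) \<longlonglongrightarrow> f u"
  shows "\<exists>d. (f has_derivative (\<lambda>h. h *\<^sub>C d)) (at z)"
proof -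
  define S where "S = ball z (R / 2)"
  have zS: "z \<in> S" using R by (simp add: S_def)
  have SR: "u \<in> S \<Longrightarrow> u \<in> ball z R" for u using R by (auto simp: S_def)
  have ball_S: "ball u (R / 2) \<subseteq> ball z R" if "u \<in> S" for u
  proof
    fix v assume "v \<in> ball u (R / 2)"
    then show "v \<in> ball z R" using that dist_triangle[of z v u] by (simp add: S_def)
  qed
  have "\<forall>n. \<forall>u\<in>S. \<exists>d. (F n has_derivative (\<lambda>h. h *\<^sub>C d)) (at u)" using der SR by blast
  then obtain D where D: "\<And>n u. u \<in> S \<Longrightarrow> (F n has_derivative (\<lambda>h. h *\<^sub>C D n u)) (at u)"
    by metis
  have D_cau: "norm (D m u - D n u) \<le> \<epsilon> / (R / 4)"
    if u: "u \<in> S" and le: "\<And>v. v \<in> ball z R \<Longrightarrow> norm (F m v - F n v) \<le> \<epsilon>" for m n u \<epsilon>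
  proof (rule Cauchy_estimate[where F = "\<lambda>v. F m v - F n v" and c = 0 and z = u and R = "R / 2"])
    have diff: "((\<lambda>v. F m v - F n v) has_derivative (\<lambda>h. h *\<^sub>C (d - d'))) (at v)"
      if "(F m has_derivative (\<lambda>h. h *\<^sub>C d)) (at v)" "(F n has_derivative (\<lambda>h. h *\<^sub>C d')) (at v)" for d d' v
      using has_derivative_diff[OF that] by (simp add: scaleC_diff_right)
    show "((\<lambda>v. F m v - F n v) has_derivative (\<lambda>h. h *\<^sub>C (D m u - D n u))) (at u)"
      by (intro diff D u)
    show "\<exists>d. ((\<lambda>v. F m v - F n v) has_derivative (\<lambda>h. h *\<^sub>C d)) (at v)" if "v \<in> ball u (R / 2)" for v
      using der ball_S[OF u] that diff by (meson subsetD)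
    show "norm (F m v - F n v - 0) \<le> \<epsilon>" if "dist u v = R / 4" for v
    proof -
      have "v \<in> ball u (R / 2)" using that R by simp
      then show ?thesis using le[of v] ball_S[OF u] by auto
    qed
  qed (use R in auto)
  have D_uniform: "\<exists>N. \<forall>m\<ge>N. \<forall>n\<ge>N. \<forall>u\<in>S. norm (D m u - D n u) \<le> \<epsilon>" if \<epsilon>: "0 < \<epsilon>" for \<epsilon>
  proof -
    have "0 < \<epsilon> * (R / 4)" using \<epsilon> R by simp
    then obtain N where "\<forall>m\<ge>N. \<forall>n\<ge>N. \<forall>u\<in>ball z R. norm (F m u - F n u) \<le> \<epsilon> * (R / 4)"
      using cau by blast
    then have "\<forall>m\<ge>N. \<forall>n\<ge>N. \<forall>u\<in>S. norm (D m u - D n u) \<le> \<epsilon> * (R / 4) / (R / 4)"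
      by (intro allI impI ballI D_cau) auto
    then show ?thesis using R by auto
  qed
  have "\<exists>g. (\<lambda>n. D n u) \<longlonglongrightarrow> g" if u: "u \<in> S" for u
  proof -
    have "Cauchy (\<lambda>n. D n u)"
    proof (rule metric_CauchyI)
      fix e :: real assume "0 < e"
      then obtain N where N: "\<forall>m\<ge>N. \<forall>n\<ge>N. \<forall>u\<in>S. norm (D m u - D n u) \<le> e / 2"
        using D_uniform[of "e / 2"] by auto
      have "dist (D m u) (D n u) < e" if "m \<ge> N" "n \<ge> N" for m n
      proof -
        have "norm (D m u - D n u) \<le> e / 2" using N that u by blast
        then show ?thesis using \<open>0 < e\<close> by (simp add: dist_norm)
      qed
      then show "\<exists>N. \<forall>m\<ge>N. \<forall>n\<ge>N. dist (D m u) (D n u) < e" by blast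
    qed
    then show ?thesis by (simp add: Cauchy_convergent_iff convergent_def)
  qed
  then obtain g where g: "\<And>u. u \<in> S \<Longrightarrow> (\<lambda>n. D n u) \<longlonglongrightarrow> g u" by metis
  have "\<exists>G. \<forall>u\<in>S. (\<lambda>n. F n u) \<longlonglongrightarrow> G u \<and> (G has_derivative (\<lambda>h. h *\<^sub>C g u)) (at u within S)"
  proof (rule has_derivative_sequence[where f' = "\<lambda>n u h. h *\<^sub>C D n u", OF _ _ _ zS lim])
    show "convex S" by (simp add: S_def)
    show "(F n has_derivative (\<lambda>h. h *\<^sub>C D n u)) (at u within S)" if "u \<in> S" for n u
      by (rule has_derivative_at_withinI[OF D[OF that]])
    show "\<forall>\<^sub>F n in sequentially. \<forall>u\<in>S. \<forall>h. norm (h *\<^sub>C D n u - h *\<^sub>C g u) \<le> e * norm h" if e: "0 < e" for e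
    proof -
      obtain N where N: "\<forall>m\<ge>N. \<forall>n\<ge>N. \<forall>u\<in>S. norm (D m u - D n u) \<le> e"
        using D_uniform[OF e] by blast
      have "norm (D n u - g u) \<le> e" if "n \<ge> N" "u \<in> S" for n u
      proof (rule tendsto_upperbound)
        show "(\<lambda>m. norm (D n u - D m u)) \<longlonglongrightarrow> norm (D n u - g u)"
          by (intro tendsto_intros g that)
        show "\<forall>\<^sub>F m in sequentially. norm (D n u - D m u) \<le> e"
          using N that by (auto intro!: eventually_sequentiallyI[of N])
      qed simp
      then have "\<forall>u\<in>S. \<forall>h. norm (h *\<^sub>C D n u - h *\<^sub>C g u) \<le> e * norm h" if "n \<ge> N" for n
        using that by (auto simp: norm_scaleC mult.commute[of e] intro!: mult_left_mono
            simp flip: scaleC_diff_right)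
      then show ?thesis by (rule eventually_sequentiallyI)
    qed
  qed (use zS R in auto)
  then obtain G where G: "\<And>u. u \<in> S \<Longrightarrow> (\<lambda>n. F n u) \<longlonglongrightarrow> G u"
    "\<And>u. u \<in> S \<Longrightarrow> (G has_derivative (\<lambda>h. h *\<^sub>C g u)) (at u within S)" by blast
  have "G u = f u" if "u \<in> S" for u
    using LIMSEQ_unique[OF G(1)[OF that] lim[OF SR[OF that]]] .
  moreover have "open S" by (simp add: S_def)
  moreover have "(G has_derivative (\<lambda>h. h *\<^sub>C g z)) (at z)"
    using G(2)[OF zS] unfolding at_within_open[OF zS \<open>open S\<close>] .
  ultimately have "(f has_derivative (\<lambda>h. h *\<^sub>C g z)) (at z)"
    using zS by (intro has_derivative_transform_within_open[of G _ z UNIV S f])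
  then show ?thesis ..
qed

text \<open>
  The pointwise limit \<open>f\<close> of a Cauchy sequence inherits, by passing to the limit in one index, the
  bounds for \<open>F n - f\<close> in both parts of the norm. Comparison with one \<open>F N\<close> then gives the Lipschitz and
  the little Lipschitz condition for \<open>f\<close>.
\<close>

lemma mcomplete_lip_A:
  "Metric_space.mcomplete (lip_A UNIV \<alpha> :: (complex \<Rightarrow> 'a::{complex_normed_vector, banach}) set) (Lip_dist \<alpha>)"
proof -
  interpret Metric_space "lip_A UNIV \<alpha>" "Lip_dist \<alpha> :: (complex \<Rightarrow> 'a) \<Rightarrow> _" by (rule Metric_space_lip_A)
  have "\<exists>f. limitin mtopology F f sequentially" if "MCauchy F" for F
  proof -
    have FL: "F n \<in> lip_A UNIV \<alpha>" for n using that by (auto simp: MCauchy_def)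
    have cau: "\<exists>N. \<forall>m\<ge>N. \<forall>n\<ge>N. Lip_dist \<alpha> (F m) (F n) < \<epsilon>" if "0 < \<epsilon>" for \<epsilon>
      using \<open>MCauchy F\<close> that unfolding MCauchy_def by meson
    have F0: "F n z = 0" if "z \<notin> cball 0 1" for n z
      using FL[of n] that by (simp add: lip_A_def Lip_A_def disk_algebra_def)
    have "\<exists>l. (\<lambda>n. F n z) \<longlonglongrightarrow> l" for z
    proof (cases "z \<in> cball 0 1")
      case True
      have "Cauchy (\<lambda>n. F n z)"
      proof (rule metric_CauchyI)
        fix e :: real assume "0 < e"
        then obtain N where N: "\<forall>m\<ge>N. \<forall>n\<ge>N. Lip_dist \<alpha> (F m) (F n) < e" using cau by blast
        have "dist (F m z) (F n z) < e" if "m \<ge> N" "n \<ge> N" for m n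
          using le_Lip_dist(1)[OF FL FL True] N that unfolding dist_norm by (meson le_less_trans)
        then show "\<exists>N. \<forall>m\<ge>N. \<forall>n\<ge>N. dist (F m z) (F n z) < e" by blast
      qed
      then show ?thesis by (simp add: Cauchy_convergent_iff convergent_def)
    qed (auto simp: F0)
    then obtain f where f: "\<And>z. (\<lambda>n. F n z) \<longlonglongrightarrow> f z" by metis
    have f0: "f z = 0" if "z \<notin> cball 0 1" for z
      using f[of z] by (simp add: F0[OF that] LIMSEQ_const_iff)
    have close: "\<exists>N. \<forall>n\<ge>N. (\<forall>z\<in>cball 0 1. norm (F n z - f z) \<le> \<epsilon>) \<and>
       (\<forall>z\<in>cball 0 1. \<forall>w\<in>cball 0 1. norm ((F n z - F n w) - (f z - f w)) \<le> \<epsilon> * norm (z - w) powr \<alpha>)"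
      if \<epsilon>: "0 < \<epsilon>" for \<epsilon>
    proof -
      obtain N where N: "\<forall>m\<ge>N. \<forall>n\<ge>N. Lip_dist \<alpha> (F m) (F n) < \<epsilon>" using cau[OF \<epsilon>] by blast
      have 1: "norm (F n z - f z) \<le> \<epsilon>" if n: "n \<ge> N" and z: "z \<in> cball 0 1" for n z
      proof (rule tendsto_upperbound)
        show "(\<lambda>m. norm (F n z - F m z)) \<longlonglongrightarrow> norm (F n z - f z)" by (intro tendsto_intros f)
        have "norm (F n z - F m z) \<le> \<epsilon>" if "m \<ge> N" for m
          using le_Lip_dist(1)[OF FL FL z, of n m] N n that by (meson less_imp_le order_trans)
        then show "\<forall>\<^sub>F m in sequentially. norm (F n z - F m z) \<le> \<epsilon>"
          by (rule eventually_sequentiallyI)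
      qed simp
      have 2: "norm ((F n z - F n w) - (f z - f w)) \<le> \<epsilon> * norm (z - w) powr \<alpha>"
        if n: "n \<ge> N" and z: "z \<in> cball 0 1" and w: "w \<in> cball 0 1" for n z w
      proof (rule tendsto_upperbound)
        show "(\<lambda>m. norm ((F n z - F n w) - (F m z - F m w))) \<longlonglongrightarrow> norm ((F n z - F n w) - (f z - f w))"
          by (intro tendsto_intros f)
        have "norm ((F n z - F n w) - (F m z - F m w)) \<le> \<epsilon> * norm (z - w) powr \<alpha>" if "m \<ge> N" for m
        proof -
          have "Lip_dist \<alpha> (F n) (F m) * norm (z - w) powr \<alpha> \<le> \<epsilon> * norm (z - w) powr \<alpha>"
            using N n that by (intro mult_right_mono) (auto intro: less_imp_le)
          then show ?thesis using le_Lip_dist(2)[OF FL FL z w, of n m] by linarith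
        qed
        then show "\<forall>\<^sub>F m in sequentially. norm ((F n z - F n w) - (F m z - F m w)) \<le> \<epsilon> * norm (z - w) powr \<alpha>"
          by (rule eventually_sequentiallyI)
      qed simp
      show ?thesis using 1 2 by blast
    qed
    have fL: "f \<in> lip_A UNIV \<alpha>"
    proof -
      have "uniform_limit (cball 0 1) F f sequentially"
      proof (rule uniform_limitI)
        fix e :: real assume e: "0 < e"
        then obtain N where N: "\<forall>n\<ge>N. \<forall>z\<in>cball 0 1. norm (F n z - f z) \<le> e / 2"
          using close[of "e / 2"] by auto
        have "\<forall>z\<in>cball 0 1. dist (F n z) (f z) < e" if "n \<ge> N" for n
        proof
          fix z :: complex assume "z \<in> cball 0 1"
          then have "norm (F n z - f z) \<le> e / 2" using N that by blast
          then show "dist (F n z) (f z) < e" using e by (simp add: dist_norm)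
        qed
        then show "\<forall>\<^sub>F n in sequentially. \<forall>z\<in>cball 0 1. dist (F n z) (f z) < e"
          by (rule eventually_sequentiallyI)
      qed
      moreover have "continuous_on (cball 0 1) (F n)" for n
        using FL[of n] by (simp add: lip_A_def Lip_A_def disk_algebra_def)
      ultimately have cont: "continuous_on (cball 0 1) f"
        by (intro uniform_limit_theorem[of _ F]) auto
      have der: "\<exists>d. (f has_derivative (\<lambda>h. h *\<^sub>C d)) (at z)" if z: "z \<in> ball 0 1" for z
      proof (rule uniform_limit_complex_differentiable[OF _ _ _ f])
        let ?R = "(1 - (norm z)\<^sup>2) / 2"
        have z1: "norm z < 1" using z by simp
        note b = ball_subset_unit_ball[OF z1]
        show "0 < ?R" using b(2) by simp
        show "\<exists>d. (F n has_derivative (\<lambda>h. h *\<^sub>C d)) (at u)" if "u \<in> ball z ?R" for n u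
        proof -
          have "norm u < 1" using b(1) that by auto
          moreover have "F n \<in> disk_algebra UNIV" using FL[of n] by (simp add: lip_A_def Lip_A_def)
          ultimately show ?thesis by (auto elim: disk_algebra_derivative)
        qed
        show "\<exists>N. \<forall>m\<ge>N. \<forall>n\<ge>N. \<forall>u\<in>ball z ?R. norm (F m u - F n u) \<le> \<epsilon>" if \<epsilon>: "0 < \<epsilon>" for \<epsilon>
        proof -
          obtain N where N: "\<forall>m\<ge>N. \<forall>n\<ge>N. Lip_dist \<alpha> (F m) (F n) < \<epsilon>" using cau[OF \<epsilon>] by blast
          have "norm (F m u - F n u) \<le> \<epsilon>" if "m \<ge> N" "n \<ge> N" "u \<in> ball z ?R" for m n u
          proof -
            have "u \<in> cball 0 1" using b(1) that(3) by auto
            then show ?thesis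
              using le_Lip_dist(1)[OF FL FL, of u m n] N that(1,2) by (meson less_imp_le order_trans)
          qed
          then show ?thesis by blast
        qed
      qed
      have fd: "f \<in> disk_algebra UNIV"
        unfolding disk_algebra_def using cont der f0 by auto
      from close[OF zero_less_one] obtain N where N: "\<forall>n\<ge>N. (\<forall>z\<in>cball 0 1. norm (F n z - f z) \<le> 1) \<and>
        (\<forall>z\<in>cball 0 1. \<forall>w\<in>cball 0 1.
          norm ((F n z - F n w) - (f z - f w)) \<le> 1 * norm (z - w) powr \<alpha>)" ..
      have "norm (f z - f w) \<le> (Lip_norm \<alpha> (F N) + 1) * norm (z - w) powr \<alpha>"
        if zw: "z \<in> cball 0 1" "w \<in> cball 0 1" for z w
      proof -
        have "F N \<in> Lip_A UNIV \<alpha>" using FL[of N] by (simp add: lip_A_def)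
        then have "norm (F N z - F N w) \<le> Lip_norm \<alpha> (F N) * norm (z - w) powr \<alpha>"
          by (rule Lip_A_le[OF _ zw])
        moreover have "norm ((F N z - F N w) - (f z - f w)) \<le> 1 * norm (z - w) powr \<alpha>" using N zw by blast
        ultimately show ?thesis
          using norm_triangle_sub[of "f z - f w" "F N z - F N w"]
          by (simp add: norm_minus_commute algebra_simps)
      qed
      then have "bdd_above (Lip_quotients \<alpha> f)"
        by (rule Lip_quotients_le(2))
      moreover have "uniformly_lip \<alpha> {f}"
        unfolding uniformly_lip_def
      proof (intro allI impI)
        fix \<epsilon> :: real assume \<epsilon>: "0 < \<epsilon>"
        then have \<epsilon>2: "0 < \<epsilon> / 2" by simp
        from close[OF \<epsilon>2] obtain N where N: "\<forall>n\<ge>N. (\<forall>z\<in>cball 0 1. norm (F n z - f z) \<le> \<epsilon> / 2) \<and>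
          (\<forall>z\<in>cball 0 1. \<forall>w\<in>cball 0 1.
            norm ((F n z - F n w) - (f z - f w)) \<le> \<epsilon> / 2 * norm (z - w) powr \<alpha>)" ..
        have "uniformly_lip \<alpha> {F N}" using FL[of N] by (simp add: lip_A_iff)
        then obtain \<delta> where \<delta>: "0 < \<delta>" "\<And>g z w. g \<in> {F N} \<Longrightarrow> z \<in> cball 0 1 \<Longrightarrow> w \<in> cball 0 1 \<Longrightarrow>
           norm (z - w) < \<delta> \<Longrightarrow> norm (g z - g w) \<le> \<epsilon> / 2 * norm (z - w) powr \<alpha>"
          by (rule uniformly_lipD[OF _ \<epsilon>2]) blast
        have "norm (f z - f w) \<le> \<epsilon> * norm (z - w) powr \<alpha>"
          if zw: "z \<in> cball 0 1" "w \<in> cball 0 1" "norm (z - w) < \<delta>" for z w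
        proof -
          have "norm ((F N z - F N w) - (f z - f w)) \<le> \<epsilon> / 2 * norm (z - w) powr \<alpha>" using N zw by blast
          with \<delta>(2)[OF _ zw, of "F N"] show ?thesis
            using norm_triangle_sub[of "f z - f w" "F N z - F N w"] by (simp add: norm_minus_commute)
        qed
        then show "\<exists>\<delta>>0. \<forall>f\<in>{f}. \<forall>z\<in>cball 0 1. \<forall>w\<in>cball 0 1.
            norm (z - w) < \<delta> \<longrightarrow> norm (f z - f w) \<le> \<epsilon> * norm (z - w) powr \<alpha>"
          using \<delta>(1) by blast
      qed
      ultimately show ?thesis using fd by (simp add: lip_A_iff Lip_A_def)
    qed
    have "limitin mtopology F f sequentially"
      unfolding limit_metric_sequentially
    proof (intro conjI fL allI impI)
      fix \<epsilon> :: real assume \<epsilon>: "0 < \<epsilon>"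
      then have \<epsilon>3: "0 < \<epsilon> / 3" by simp
      from close[OF \<epsilon>3] obtain N where N: "\<forall>n\<ge>N. (\<forall>z\<in>cball 0 1. norm (F n z - f z) \<le> \<epsilon> / 3) \<and>
       (\<forall>z\<in>cball 0 1. \<forall>w\<in>cball 0 1. norm ((F n z - F n w) - (f z - f w)) \<le> \<epsilon> / 3 * norm (z - w) powr \<alpha>)" ..
      have "Lip_dist \<alpha> (F n) f \<le> \<epsilon> / 3 + \<epsilon> / 3" if "n \<ge> N" for n
        using N[rule_format, OF that] by (intro Lip_dist_le FL fL) auto
      moreover have "\<epsilon> / 3 + \<epsilon> / 3 < \<epsilon>" using \<epsilon> by simp
      ultimately show "\<exists>N. \<forall>n\<ge>N. F n \<in> lip_A UNIV \<alpha> \<and> Lip_dist \<alpha> (F n) f < \<epsilon>"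
        using FL by (meson le_less_trans)
    qed
    then show ?thesis by blast
  qed
  then show ?thesis by (simp add: mcomplete_def)
qed

lemma lip_compact_iff_totally_bounded:
  fixes W :: "(complex \<Rightarrow> 'a::complex_normed_vector) \<Rightarrow> complex \<Rightarrow> 'b::{complex_normed_vector, banach}"
  shows "lip_compact \<alpha> \<beta> W \<longleftrightarrow> W ` lip_A UNIV \<alpha> \<subseteq> lip_A UNIV \<beta> \<and>
     Metric_space.mtotally_bounded (lip_A UNIV \<beta>) (Lip_dist \<beta>)
       (W ` {f \<in> lip_A UNIV \<alpha>. Lip_norm \<alpha> f \<le> 1})"
proof -
  interpret Metric_space "lip_A UNIV \<beta>" "Lip_dist \<beta> :: (complex \<Rightarrow> 'b) \<Rightarrow> _" by (rule Metric_space_lip_A)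
  show ?thesis
    unfolding lip_compact_def lip_topology_def mtotally_bounded_eq_compact_closure_of[OF mcomplete_lip_A]
    by blast
qed

section \<open>Functions in the unit ball\<close>

text \<open>
  Constants have to be cut off because members of the function spaces are zero off the closed disk.
\<close>

definition constant_map :: "'a::zero \<Rightarrow> complex \<Rightarrow> 'a" where
  "constant_map x u = (if u \<in> cball 0 1 then x else 0)"

lemma constant_map_lip_A:
  "constant_map x \<in> lip_A UNIV \<alpha>" "Lip_norm \<alpha> (constant_map x) \<le> norm x"
proof -
  have "\<exists>d. (constant_map x has_derivative (\<lambda>h. h *\<^sub>C d)) (at z)" if z: "z \<in> ball 0 1" for z
  proof (rule exI[of _ 0], rule has_derivative_transform_within_open[where f = "\<lambda>_. x" and s = "ball 0 1"])
    show "((\<lambda>_. x) has_derivative (\<lambda>h. h *\<^sub>C 0)) (at z)" by (simp add: scaleC_zero_right)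
  qed (use z in \<open>auto simp: constant_map_def\<close>)
  moreover have "continuous_on (cball 0 1) (constant_map x)"
    by (rule continuous_on_eq[where f = "\<lambda>_. x"]) (auto simp: constant_map_def)
  ultimately have "constant_map x \<in> disk_algebra UNIV"
    by (simp add: disk_algebra_def) (simp add: constant_map_def)
  moreover have le: "norm (constant_map x z - constant_map x w) \<le> 0 * norm (z - w) powr \<alpha>"
    if "z \<in> cball 0 1" "w \<in> cball 0 1" for z w
    using that by (simp add: constant_map_def)
  moreover have "uniformly_lip \<alpha> {constant_map x}"
    unfolding uniformly_lip_def by (intro allI impI exI[of _ 1]) (auto simp: constant_map_def)
  ultimately show "constant_map x \<in> lip_A UNIV \<alpha>"
    using Lip_quotients_le(2)[OF le] by (simp add: lip_A_iff Lip_A_def)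
  have "Lip_norm \<alpha> (constant_map x) \<le> norm x + 0"
    by (rule Lip_norm_le[OF _ le]) (auto simp: constant_map_def)
  then show "Lip_norm \<alpha> (constant_map x) \<le> norm x" by simp
qed

lemma min_one_le_powr:
  fixes t \<alpha> :: real
  assumes "0 \<le> t" "0 < \<alpha>" "\<alpha> \<le> 1"
  shows "min 1 t \<le> t powr \<alpha>"
proof (cases "t \<le> 1")
  case True
  then show ?thesis using assms powr_mono'[of \<alpha> 1 t] by (cases "t = 0") auto
next
  case False
  then show ?thesis using ge_one_powr_ge_zero[of t \<alpha>] assms by simp
qed

definition disk_aut :: "complex \<Rightarrow> complex \<Rightarrow> complex" where
  "disk_aut a u = (u - a) / (1 - cnj a * u)"

text \<open>
  For \<open>s = 1 - |a|\<^sup>2\<close> the Lipschitz constant is of order \<open>1 / s\<close>, which is also the derivative at \<open>a\<close>.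
  This is what makes the automorphisms extremal for the growth of derivatives.
\<close>

lemma disk_automorphism:
  fixes a :: complex
  assumes a: "norm a < 1"
  shows "norm u \<le> 1 \<Longrightarrow> 1 - cnj a * u \<noteq> 0"
    and "norm u \<le> 1 \<Longrightarrow> norm (disk_aut a u) \<le> 1"
    and "norm u \<le> 1 \<Longrightarrow> norm v \<le> 1 \<Longrightarrow> norm (disk_aut a u - disk_aut a v) \<le> 4 * (norm (u - v) / (1 - (norm a)\<^sup>2))"
    and "norm u \<le> 1 \<Longrightarrow> disk_aut a field_differentiable at u"
    and "(disk_aut a has_field_derivative complex_of_real (1 / (1 - (norm a)\<^sup>2))) (at a)"
proof -
  have low: "1 - norm a \<le> norm (1 - cnj a * u)" if "norm u \<le> 1" for u
  proof -
    have "norm (cnj a * u) \<le> norm a" using that by (simp add: norm_mult mult_left_le)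
    then show ?thesis using norm_triangle_ineq2[of 1 "cnj a * u"] by simp
  qed
  show nz: "1 - cnj a * u \<noteq> 0" if "norm u \<le> 1" for u
    using low[OF that] a by auto
  have sq: "0 < 1 - (norm a)\<^sup>2" using ball_subset_unit_ball(2)[OF a] .
  show "norm (disk_aut a u) \<le> 1" if u: "norm u \<le> 1" for u
  proof -
    have "(norm (1 - cnj a * u))\<^sup>2 - (norm (u - a))\<^sup>2 = (1 - (norm a)\<^sup>2) * (1 - (norm u)\<^sup>2)"
      unfolding cmod_power2 by (simp add: power2_eq_square algebra_simps)
    moreover have "0 \<le> (1 - (norm a)\<^sup>2) * (1 - (norm u)\<^sup>2)"
      using sq u by (intro mult_nonneg_nonneg) (auto simp: power_le_one)
    ultimately have "(norm (u - a))\<^sup>2 \<le> (norm (1 - cnj a * u))\<^sup>2" by linarith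
    then have "norm (u - a) \<le> norm (1 - cnj a * u)" by (rule power2_le_imp_le) simp
    then show ?thesis using nz[OF u] by (simp add: disk_aut_def norm_divide)
  qed
  show "norm (disk_aut a u - disk_aut a v) \<le> 4 * (norm (u - v) / (1 - (norm a)\<^sup>2))"
    if uv: "norm u \<le> 1" "norm v \<le> 1" for u v
  proof -
    have aa: "cnj a * a = complex_of_real ((norm a)\<^sup>2)"
      by (metis complex_norm_square mult.commute)
    have "disk_aut a u - disk_aut a v = (u - v) * (1 - cnj a * a) / ((1 - cnj a * u) * (1 - cnj a * v))"
      using nz[OF uv(1)] nz[OF uv(2)] by (simp add: disk_aut_def field_simps)
    then have "norm (disk_aut a u - disk_aut a v) = norm (u - v) * norm (1 - complex_of_real ((norm a)\<^sup>2)) /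
        (norm (1 - cnj a * u) * norm (1 - cnj a * v))"
      by (simp only: aa norm_divide norm_mult)
    also have "norm (1 - complex_of_real ((norm a)\<^sup>2)) = 1 - (norm a)\<^sup>2"
      using sq by (metis abs_of_pos norm_of_real of_real_1 of_real_diff)
    also have "norm (u - v) * (1 - (norm a)\<^sup>2) / (norm (1 - cnj a * u) * norm (1 - cnj a * v))
        \<le> norm (u - v) * (1 - (norm a)\<^sup>2) / ((1 - norm a) * (1 - norm a))"
      using low[OF uv(1)] low[OF uv(2)] a sq
      by (intro divide_left_mono mult_mono mult_pos_pos) auto
    also have "\<dots> = norm (u - v) * (1 + norm a)\<^sup>2 / (1 - (norm a)\<^sup>2)"
    proof -
      have "1 - (norm a)\<^sup>2 = (1 - norm a) * (1 + norm a)" by (simp add: power2_eq_square algebra_simps)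
      moreover have "1 - norm a \<noteq> 0" "1 + norm a \<noteq> 0" using a norm_ge_zero[of a] by linarith+
      ultimately show ?thesis by (simp add: power2_eq_square)
    qed
    also have "\<dots> \<le> norm (u - v) * 2\<^sup>2 / (1 - (norm a)\<^sup>2)"
      using a sq by (intro divide_right_mono mult_left_mono power_mono) auto
    finally show ?thesis by (simp add: mult.commute)
  qed
  show "disk_aut a field_differentiable at u" if "norm u \<le> 1" for u
    unfolding disk_aut_def[abs_def] using nz[OF that] by (intro derivative_intros) auto
  have "(disk_aut a has_field_derivative ((1 - 0) * (1 - cnj a * a) - (a - a) * (0 - cnj a * 1)) /
      ((1 - cnj a * a) * (1 - cnj a * a))) (at a)"
    unfolding disk_aut_def[abs_def] using nz[of a] a by (auto intro!: derivative_eq_intros)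
  moreover have "((1 - 0) * (1 - cnj a * a) - (a - a) * (0 - cnj a * 1)) / ((1 - cnj a * a) * (1 - cnj a * a))
     = complex_of_real (1 / (1 - (norm a)\<^sup>2))"
    using nz[of a] a complex_norm_square[of a] by (simp add: mult.commute)
  ultimately show "(disk_aut a has_field_derivative complex_of_real (1 / (1 - (norm a)\<^sup>2))) (at a)" by simp
qed

text \<open>
  With \<open>s = 1 - |a|\<^sup>2\<close> take \<open>s powr \<alpha> / 5\<close> times the automorphism times \<open>x\<close>. Two values of the automorphism
  differ by at most \<open>4 min 1 t \<le> 4 (t powr \<alpha>)\<close> for \<open>t = |u - v| / s\<close>, and the factor \<open>s powr \<alpha>\<close> turns
  this into a Lipschitz condition with a constant that does not depend on \<open>a\<close>. The factor 1/5 puts the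
  norm below \<open>1 / 5 + 4 / 5\<close>. The function is Lipschitz of order 1, hence little Lipschitz of any order
  below 1.
\<close>

lemma test_function:
  fixes a :: complex and x :: "'a::complex_normed_vector"
  assumes a: "norm a < 1" and \<alpha>: "0 < \<alpha>" "\<alpha> < 1" and x: "norm x \<le> 1"
  obtains f where "f \<in> lip_A UNIV \<alpha>" "Lip_norm \<alpha> f \<le> 1" "f a = 0"
    "(f has_derivative (\<lambda>h. h *\<^sub>C ((1 - (norm a)\<^sup>2) powr (\<alpha> - 1) / 5) *\<^sub>R x)) (at a)"
proof -
  define s where "s = 1 - (norm a)\<^sup>2"
  have s: "0 < s" "s \<le> 1" using ball_subset_unit_ball(2)[OF a] by (auto simp: s_def)
  define m where "m = disk_aut a"
  note m = disk_automorphism[OF a, folded m_def s_def]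
  define c where "c = complex_of_real (s powr \<alpha> / 5)"
  have nc: "norm c = s powr \<alpha> / 5" unfolding c_def norm_of_real by simp
  define f where "f u = (if u \<in> cball 0 1 then (c * m u) *\<^sub>C x else 0)" for u
  have f': "(f has_derivative (\<lambda>h. h *\<^sub>C (c * d) *\<^sub>C x)) (at u)"
    if u: "u \<in> ball 0 1" and d: "(m has_field_derivative d) (at u)" for u d
  proof (rule has_derivative_transform_within_open[where f = "\<lambda>u. (c * m u) *\<^sub>C x" and s = "ball 0 1"])
    have "((\<lambda>u. c * m u) has_field_derivative c * d) (at u)" by (rule DERIV_cmult[OF d])
    then have "((\<lambda>u. (c * m u) *\<^sub>C x) has_derivative (\<lambda>h. (c * d * h) *\<^sub>C x)) (at u)"
      unfolding has_field_derivative_def by (rule bounded_linear.has_derivative[OF bounded_linear_scaleC_left])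
    then show "((\<lambda>u. (c * m u) *\<^sub>C x) has_derivative (\<lambda>h. h *\<^sub>C (c * d) *\<^sub>C x)) (at u)"
      by (simp add: scaleC_scaleC mult.commute)
  qed (use u in \<open>auto simp: f_def\<close>)
  have "\<exists>d. (f has_derivative (\<lambda>h. h *\<^sub>C d)) (at u)" if u: "u \<in> ball 0 1" for u
  proof -
    obtain d where "(m has_field_derivative d) (at u)"
      using m(4)[of u] u by (auto simp: field_differentiable_def)
    from f'[OF u this] show ?thesis by blast
  qed
  moreover have "continuous_on (cball 0 1) f"
  proof (rule continuous_on_eq[where f = "\<lambda>u. (c * m u) *\<^sub>C x"])
    have "continuous_on (cball 0 1) m"
      unfolding m_def disk_aut_def[abs_def] using m(1) by (intro continuous_intros) auto
    then show "continuous_on (cball 0 1) (\<lambda>u. (c * m u) *\<^sub>C x)"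
      by (intro bounded_linear.continuous_on[OF bounded_linear_scaleC_left] continuous_intros)
  qed (simp add: f_def)
  ultimately have fd: "f \<in> disk_algebra UNIV" by (auto simp: disk_algebra_def f_def)
  have diff: "norm (f u - f v) \<le> s powr \<alpha> / 5 * norm (m u - m v)"
    if "u \<in> cball 0 1" "v \<in> cball 0 1" for u v
  proof -
    have "f u - f v = (c * (m u - m v)) *\<^sub>C x"
      using that scaleC_add_left[of "c * (m u - m v)" "c * m v" x] by (simp add: f_def algebra_simps)
    then have "norm (f u - f v) = norm c * norm (m u - m v) * norm x"
      by (simp only: norm_scaleC norm_mult)
    also have "\<dots> \<le> norm c * norm (m u - m v) * 1" using x by (intro mult_left_mono) auto
    finally show ?thesis by (simp add: nc)
  qed
  have lip: "norm (f u - f v) \<le> 4 / 5 * norm (u - v) powr \<alpha>"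
    if uv: "u \<in> cball 0 1" "v \<in> cball 0 1" for u v
  proof -
    define t where "t = norm (u - v) / s"
    have t: "0 \<le> t" using s by (simp add: t_def)
    have "norm (m u - m v) \<le> norm (m u) + norm (m v)" by (rule norm_triangle_ineq4)
    then have "norm (m u - m v) \<le> 4 * min 1 t"
      using m(2)[of u] m(2)[of v] m(3)[of u v] uv by (auto simp: t_def min_def)
    also have "\<dots> \<le> 4 * t powr \<alpha>" using min_one_le_powr[OF t, of \<alpha>] \<alpha> by simp
    also have "\<dots> = 4 * norm (u - v) powr \<alpha> / s powr \<alpha>" using s by (simp add: t_def powr_divide)
    finally have "s powr \<alpha> / 5 * norm (m u - m v) \<le> s powr \<alpha> / 5 * (4 * norm (u - v) powr \<alpha> / s powr \<alpha>)"
      by (intro mult_left_mono) auto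
    also have "\<dots> = 4 / 5 * norm (u - v) powr \<alpha>" using s by simp
    finally show ?thesis using diff[OF uv] by linarith
  qed
  have sup: "norm (f u) \<le> 1 / 5" if u: "u \<in> cball 0 1" for u
  proof -
    have "norm (f u) = s powr \<alpha> / 5 * norm (m u) * norm x"
      using u by (simp only: f_def if_True norm_scaleC norm_mult nc)
    also have "\<dots> \<le> 1 / 5 * 1 * 1"
      using m(2)[of u] u x s \<alpha> powr_le1[of \<alpha> s] by (intro mult_mono) auto
    finally show ?thesis by simp
  qed
  have "f \<in> lip_A UNIV \<alpha>"
  proof (rule lip_A_Lipschitz[OF fd \<alpha>(2) _ lip])
    show "norm (f u - f v) \<le> s powr \<alpha> / 5 * (4 / s) * norm (u - v)"
      if uv: "u \<in> cball 0 1" "v \<in> cball 0 1" for u v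
    proof -
      have "s powr \<alpha> / 5 * norm (m u - m v) \<le> s powr \<alpha> / 5 * (4 * (norm (u - v) / s))"
        using m(3)[of u v] uv by (intro mult_left_mono) auto
      then have "norm (f u - f v) \<le> s powr \<alpha> / 5 * (4 * (norm (u - v) / s))"
        using diff[OF uv] by linarith
      then show ?thesis by (simp add: algebra_simps)
    qed
  qed (use s in auto)
  moreover have "Lip_norm \<alpha> f \<le> 1 / 5 + 4 / 5" by (rule Lip_norm_le[OF sup lip])
  moreover have "f a = 0" by (simp add: f_def m_def disk_aut_def scaleC_zero_left)
  moreover have "(f has_derivative (\<lambda>h. h *\<^sub>C (s powr (\<alpha> - 1) / 5) *\<^sub>R x)) (at a)"
  proof -
    have "(f has_derivative (\<lambda>h. h *\<^sub>C (c * complex_of_real (1 / s)) *\<^sub>C x)) (at a)"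
      using a m(5) by (intro f') auto
    moreover have "c * complex_of_real (1 / s) = complex_of_real (s powr (\<alpha> - 1) / 5)"
      using s by (simp add: c_def powr_diff)
    ultimately show ?thesis by (simp only: scaleC_of_real)
  qed
  ultimately show ?thesis using that by (simp add: s_def)
qed

section \<open>Weighted composition operators\<close>

text \<open>
  The product and chain rules; complex linearity of \<open>\<Psi> z\<close> lets the factor \<open>h\<close> come out.
\<close>

lemma weighted_comp_has_derivative:
  fixes \<Psi> :: "complex \<Rightarrow> 'a::complex_normed_vector \<Rightarrow>\<^sub>L 'b::complex_normed_vector"
  assumes z: "norm z < 1"
    and \<Psi>: "\<Psi> z \<in> bounded_ops" "(\<Psi> has_derivative (\<lambda>h. h *\<^sub>C T)) (at z)"
    and \<phi>: "(\<phi> has_field_derivative d) (at z)"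
    and f: "(f has_derivative (\<lambda>h. h *\<^sub>C D)) (at (\<phi> z))"
  shows "(weighted_comp \<Psi> \<phi> f has_derivative (\<lambda>h. h *\<^sub>C (T (f (\<phi> z)) + d *\<^sub>C \<Psi> z D))) (at z)"
proof (rule has_derivative_transform_within_open[where f = "\<lambda>z. \<Psi> z (f (\<phi> z))" and s = "ball 0 1"])
  have "((\<lambda>z. f (\<phi> z)) has_derivative (\<lambda>h. (d * h) *\<^sub>C D)) (at z)"
    using has_derivative_compose[OF \<phi>[unfolded has_field_derivative_def] f] .
  then have "((\<lambda>z. \<Psi> z (f (\<phi> z))) has_derivative
      (\<lambda>h. \<Psi> z ((d * h) *\<^sub>C D) + (h *\<^sub>C T) (f (\<phi> z)))) (at z)"
    by (rule blinfun.FDERIV[OF \<Psi>(2)])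
  moreover have "\<Psi> z ((d * h) *\<^sub>C D) + (h *\<^sub>C T) (f (\<phi> z)) = h *\<^sub>C (T (f (\<phi> z)) + d *\<^sub>C \<Psi> z D)" for h
    using \<Psi>(1) by (simp add: bounded_ops_def scaleC_blinfun_apply scaleC_add_right scaleC_scaleC mult.commute add.commute)
  ultimately show "((\<lambda>z. \<Psi> z (f (\<phi> z))) has_derivative (\<lambda>h. h *\<^sub>C (T (f (\<phi> z)) + d *\<^sub>C \<Psi> z D))) (at z)"
    by simp
qed (use z in \<open>auto simp: weighted_comp_def\<close>)

text \<open>
  The maximum modulus principle, with continuity to pass from the open to the closed disk.
\<close>

lemma nonconstant_self_map:
  fixes \<phi> :: "complex \<Rightarrow> complex"
  assumes "continuous_on (cball 0 1) \<phi>" "\<phi> holomorphic_on ball 0 1"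
    and "\<phi> ` cball 0 1 \<subseteq> cball 0 1" "\<not> \<phi> constant_on cball 0 1" and z: "norm z < 1"
  shows "norm (\<phi> z) < 1"
proof (rule ccontr)
  assume "\<not> norm (\<phi> z) < 1"
  moreover have le: "norm (\<phi> u) \<le> 1" if "norm u \<le> 1" for u using assms(3) that by force
  ultimately have eq: "norm (\<phi> z) = 1" using z by (meson antisym_conv2 less_imp_le)
  have "\<phi> constant_on ball 0 1"
    by (rule maximum_modulus_principle[OF assms(2), of "ball 0 1" z]) (use z eq le in auto)
  then obtain c where c: "\<And>u. u \<in> ball 0 1 \<Longrightarrow> \<phi> u = c" by (auto simp: constant_on_def)
  have "\<phi> u = c" if "u \<in> cball 0 1" for u
    by (rule continuous_constant_on_closure[of "ball 0 1" \<phi> c]) (use assms(1) c that in auto)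
  then show False using assms(4) by (auto simp: constant_on_def)
qed

lemma norm_blinfun_le_unit:
  fixes T :: "'a::real_normed_vector \<Rightarrow>\<^sub>L 'b::real_normed_vector"
  assumes "0 \<le> B" "\<And>x. norm x \<le> 1 \<Longrightarrow> norm (T x) \<le> B"
  shows "norm T \<le> B"
proof (rule norm_blinfun_bound[OF assms(1)])
  fix x
  show "norm (T x) \<le> B * norm x"
  proof (cases "x = 0")
    case False
    have "norm (T (inverse (norm x) *\<^sub>R x)) \<le> B" using False by (intro assms(2)) simp
    then show ?thesis using False by (simp add: blinfun.scaleR_right field_simps)
  qed (simp add: blinfun.zero_right)
qed

text \<open>
  The form in which the condition meets the derivative bounds: no quotients, and the limit written
  out.
\<close>

lemma vanishing_condition_iff:
  "vanishing_condition \<alpha> \<beta> \<phi> \<Psi> \<longleftrightarrow>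
     (\<forall>\<epsilon>>0. \<exists>s<1. \<forall>z. s < norm z \<and> norm z < 1 \<longrightarrow>
        (1 - (norm (\<phi> z))\<^sup>2) powr (\<alpha> - 1) * norm (deriv \<phi> z) * norm (\<Psi> z)
          \<le> \<epsilon> * (1 - (norm z)\<^sup>2) powr (\<beta> - 1))"
proof -
  define E where "E z = (1 - (norm z)\<^sup>2) powr (1 - \<beta>) / (1 - (norm (\<phi> z))\<^sup>2) powr (1 - \<alpha>)
      * norm (deriv \<phi> z) * norm (\<Psi> z)" for z
  define Q where "Q z = (1 - (norm (\<phi> z))\<^sup>2) powr (\<alpha> - 1) * norm (deriv \<phi> z) * norm (\<Psi> z)" for z
  have E: "E z \<ge> 0" "E z \<le> \<epsilon> \<longleftrightarrow> Q z \<le> \<epsilon> * (1 - (norm z)\<^sup>2) powr (\<beta> - 1)" if z: "norm z < 1" for z \<epsilon>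
  proof -
    have p: "0 < (1 - (norm z)\<^sup>2) powr (1 - \<beta>)" using ball_subset_unit_ball(2)[OF z] by simp
    have "a powr (x - 1) = 1 / a powr (1 - x)" for a x :: real
      using powr_minus_divide[of a "1 - x"] by simp
    then have eq: "E z = (1 - (norm z)\<^sup>2) powr (1 - \<beta>) * Q z"
      "(1 - (norm z)\<^sup>2) powr (\<beta> - 1) = 1 / (1 - (norm z)\<^sup>2) powr (1 - \<beta>)"
      by (simp_all add: E_def Q_def)
    show "E z \<ge> 0" unfolding E_def by (intro mult_nonneg_nonneg divide_nonneg_nonneg) auto
    show "E z \<le> \<epsilon> \<longleftrightarrow> Q z \<le> \<epsilon> * (1 - (norm z)\<^sup>2) powr (\<beta> - 1)"
      unfolding eq using p by (simp add: field_simps)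
  qed
  have "vanishing_condition \<alpha> \<beta> \<phi> \<Psi> \<longleftrightarrow> (E \<longlongrightarrow> 0) (filtercomap norm (at_left 1))"
    unfolding vanishing_condition_def E_def ..
  also have "\<dots> \<longleftrightarrow> (\<forall>\<epsilon>>0. \<exists>s<1. \<forall>z. s < norm z \<and> norm z < 1 \<longrightarrow> \<bar>E z\<bar> < \<epsilon>)"
  proof -
    have "eventually P (filtercomap norm (at_left 1)) \<longleftrightarrow> (\<exists>s<1. \<forall>z. s < norm z \<and> norm z < 1 \<longrightarrow> P z)"
      for P :: "complex \<Rightarrow> bool"
    proof
      assume "eventually P (filtercomap norm (at_left 1))"
      then obtain R where R: "eventually R (at_left (1::real))" "\<forall>z. R (norm z) \<longrightarrow> P z"
        by (auto simp: eventually_filtercomap)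
      then obtain s where "s < 1" "\<forall>y>s. y < 1 \<longrightarrow> R y"
        using eventually_at_left[of 0 "1::real" R] by auto
      with R(2) show "\<exists>s<1. \<forall>z. s < norm z \<and> norm z < 1 \<longrightarrow> P z" by blast
    next
      assume "\<exists>s<1. \<forall>z. s < norm z \<and> norm z < 1 \<longrightarrow> P z"
      then obtain s where s: "s < 1" "\<forall>z. s < norm z \<and> norm z < 1 \<longrightarrow> P z" by blast
      have "eventually (\<lambda>y. s < y \<and> y < 1) (at_left (1::real))"
        using eventually_at_left[of 0 "1::real"] s(1) by auto
      with s(2) show "eventually P (filtercomap norm (at_left 1))"
        unfolding eventually_filtercomap by blast
    qed
    then show ?thesis by (simp add: tendsto_iff)
  qed
  also have "\<dots> \<longleftrightarrow> (\<forall>\<epsilon>>0. \<exists>s<1. \<forall>z. s < norm z \<and> norm z < 1 \<longrightarrow>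
        Q z \<le> \<epsilon> * (1 - (norm z)\<^sup>2) powr (\<beta> - 1))"
  proof (intro iffI allI impI)
    fix \<epsilon> :: real assume *: "\<forall>\<epsilon>>0. \<exists>s<1. \<forall>z. s < norm z \<and> norm z < 1 \<longrightarrow> \<bar>E z\<bar> < \<epsilon>" and "0 < \<epsilon>"
    then obtain s where s: "s < 1" "\<forall>z. s < norm z \<and> norm z < 1 \<longrightarrow> \<bar>E z\<bar> < \<epsilon>" by blast
    have "Q z \<le> \<epsilon> * (1 - (norm z)\<^sup>2) powr (\<beta> - 1)" if z: "s < norm z \<and> norm z < 1" for z
    proof -
      have "E z \<le> \<epsilon>" using s(2) z by fastforce
      then show ?thesis using E(2) z by blast
    qed
    with s(1) show "\<exists>s<1. \<forall>z. s < norm z \<and> norm z < 1 \<longrightarrow> Q z \<le> \<epsilon> * (1 - (norm z)\<^sup>2) powr (\<beta> - 1)"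
      by blast
  next
    fix \<epsilon> :: real assume *: "\<forall>\<epsilon>>0. \<exists>s<1. \<forall>z. s < norm z \<and> norm z < 1 \<longrightarrow>
        Q z \<le> \<epsilon> * (1 - (norm z)\<^sup>2) powr (\<beta> - 1)" and \<epsilon>: "0 < \<epsilon>"
    then have "0 < \<epsilon> / 2" by simp
    with * obtain s where s: "s < 1" "\<forall>z. s < norm z \<and> norm z < 1 \<longrightarrow>
        Q z \<le> \<epsilon> / 2 * (1 - (norm z)\<^sup>2) powr (\<beta> - 1)" by blast
    have "\<bar>E z\<bar> < \<epsilon>" if z: "s < norm z \<and> norm z < 1" for z
    proof -
      have "E z \<le> \<epsilon> / 2" using s(2) z E(2) by blast
      then show ?thesis using E(1)[of z] z \<epsilon> by auto
    qed
    with s(1) show "\<exists>s<1. \<forall>z. s < norm z \<and> norm z < 1 \<longrightarrow> \<bar>E z\<bar> < \<epsilon>" by blast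
  qed
  finally show ?thesis unfolding Q_def .
qed

text \<open>
  Apply boundedness to the constants \<open>x\<close>, whose images are \<open>z \<mapsto> \<Psi> z x\<close>.
\<close>

lemma lip_bounded_symbol:
  fixes \<Psi> :: "complex \<Rightarrow> 'a::complex_normed_vector \<Rightarrow>\<^sub>L 'b::complex_normed_vector"
  assumes W: "lip_bounded \<alpha> \<beta> (weighted_comp \<Psi> \<phi>)" and \<phi>: "\<phi> ` cball 0 1 \<subseteq> cball 0 1"
  shows "bdd_above (Lip_quotients \<beta> \<Psi>)"
proof -
  obtain C where sub: "weighted_comp \<Psi> \<phi> ` lip_A UNIV \<alpha> \<subseteq> lip_A UNIV \<beta>"
    and C: "\<forall>f\<in>lip_A UNIV \<alpha>. Lip_norm \<beta> (weighted_comp \<Psi> \<phi> f) \<le> C * Lip_norm \<alpha> f"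
    using W unfolding lip_bounded_def by blast
  have "norm (\<Psi> z - \<Psi> w) \<le> \<bar>C\<bar> * norm (z - w) powr \<beta>"
    if zw: "z \<in> cball 0 1" "w \<in> cball 0 1" for z w
  proof (rule norm_blinfun_le_unit)
    fix x :: 'a assume x: "norm x \<le> 1"
    let ?W = "weighted_comp \<Psi> \<phi> (constant_map x)"
    note c = constant_map_lip_A[where x = x and \<alpha> = \<alpha>]
    have "constant_map x \<in> Lip_A UNIV \<alpha>" using c(1) by (simp add: lip_A_iff)
    from norm_le_Lip_norm[OF this, of 0] have c0: "0 \<le> Lip_norm \<alpha> (constant_map x)"
      using norm_ge_zero[of "constant_map x 0"] by (simp del: norm_ge_zero)
    have "?W \<in> lip_A UNIV \<beta>" using sub c(1) by blast
    then have "?W \<in> Lip_A UNIV \<beta>" by (simp add: lip_A_iff)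
    from Lip_A_le[OF this zw]
    have "norm (?W z - ?W w) \<le> Lip_norm \<beta> ?W * norm (z - w) powr \<beta>" .
    moreover have "Lip_norm \<beta> ?W \<le> \<bar>C\<bar> * 1"
    proof -
      have "Lip_norm \<beta> ?W \<le> C * Lip_norm \<alpha> (constant_map x)" using C c(1) by blast
      also have "\<dots> \<le> \<bar>C\<bar> * 1" using c(2) x c0 by (intro mult_mono) auto
      finally show ?thesis .
    qed
    moreover have "(\<Psi> z - \<Psi> w) x = ?W z - ?W w"
    proof -
      have "\<phi> z \<in> cball 0 1" "\<phi> w \<in> cball 0 1" using \<phi> zw by blast+
      then show ?thesis using zw by (simp add: weighted_comp_def constant_map_def blinfun.diff_left)
    qed
    ultimately show "norm ((\<Psi> z - \<Psi> w) x) \<le> \<bar>C\<bar> * norm (z - w) powr \<beta>"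
      by (metis (no_types, lifting) mult.right_neutral mult_right_mono order_trans powr_ge_zero)
  qed simp
  then show ?thesis by (rule Lip_quotients_le(2))
qed

text \<open>
  The values \<open>\<Psi> z x\<close> with \<open>\<parallel>x\<parallel> \<le> 1\<close> are among the values at \<open>z\<close> of the images of the unit ball, because
  the constants \<open>x\<close> are in it.
\<close>

lemma lip_compact_symbol:
  fixes \<Psi> :: "complex \<Rightarrow> 'a::complex_normed_vector \<Rightarrow>\<^sub>L 'b::{complex_normed_vector, banach}"
  assumes W: "lip_compact \<alpha> \<beta> (weighted_comp \<Psi> \<phi>)" and \<phi>: "\<phi> ` cball 0 1 \<subseteq> cball 0 1"
    and \<Psi>: "\<Psi> \<in> disk_algebra bounded_ops"
  shows "\<Psi> \<in> disk_algebra compact_ops"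
proof -
  let ?T = "weighted_comp \<Psi> \<phi> ` {f \<in> lip_A UNIV \<alpha>. Lip_norm \<alpha> f \<le> 1}"
  have tb: "Metric_space.mtotally_bounded (lip_A UNIV \<beta>) (Lip_dist \<beta>) ?T"
    using W by (simp add: lip_compact_iff_totally_bounded)
  have K: "\<Psi> z \<in> compact_ops" if z: "z \<in> cball 0 1" for z
  proof -
    have "blinfun_apply (\<Psi> z) ` cball 0 1 \<subseteq> (\<lambda>g. g z) ` ?T"
    proof
      fix y assume "y \<in> blinfun_apply (\<Psi> z) ` cball 0 1"
      then obtain x where x: "norm x \<le> 1" "y = \<Psi> z x" by auto
      have "weighted_comp \<Psi> \<phi> (constant_map x) \<in> ?T"
        using constant_map_lip_A[where x = x and \<alpha> = \<alpha>] x(1) by (intro imageI) auto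
      moreover have "y = weighted_comp \<Psi> \<phi> (constant_map x) z"
      proof -
        have "\<phi> z \<in> cball 0 1" using \<phi> z by blast
        then show ?thesis using z x(2) by (simp add: weighted_comp_def constant_map_def)
      qed
      ultimately show "y \<in> (\<lambda>g. g z) ` ?T" by blast
    qed
    then have "compact (closure (blinfun_apply (\<Psi> z) ` cball 0 1))"
      using pointwise_totally_bounded[OF tb z]
      unfolding compact_closure_iff_totally_bounded by (meson order_trans)
    moreover have "\<Psi> z \<in> bounded_ops" using \<Psi> z by (auto simp: disk_algebra_def)
    ultimately show ?thesis by (simp add: compact_ops_def)
  qed
  have "\<exists>D\<in>compact_ops. (\<Psi> has_derivative (\<lambda>h. h *\<^sub>C D)) (at z)" if z: "z \<in> ball 0 1" for z
  proof -
    obtain D where D: "D \<in> bounded_ops" "(\<Psi> has_derivative (\<lambda>h. h *\<^sub>C D)) (at z)"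
      using disk_algebra_derivative[OF \<Psi>, of z] z by auto
    have "eventually (\<lambda>u. u \<in> ball 0 1) (nhds z)" using z by (intro eventually_nhds_in_open) auto
    then have "eventually (\<lambda>u. \<Psi> u \<in> compact_ops) (nhds z)"
      by (rule eventually_mono) (auto intro: K)
    from compact_ops_derivative[OF D(2,1) this] D(2) show ?thesis by blast
  qed
  then show ?thesis using \<Psi> K by (auto simp: disk_algebra_def)
qed

text \<open>
  The test function at \<open>a = \<phi> z\<close> vanishes at \<open>a\<close>, so the derivative of its image at \<open>z\<close> is
  \<open>\<phi>'(z) \<Psi>(z)\<close> applied to a known multiple of \<open>x\<close>. The uniform little Lipschitz condition on the
  image of the unit ball bounds this derivative, and taking the supremum over \<open>x\<close> gives the norm of
  \<open>\<Psi> z\<close>.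
\<close>

lemma lip_compact_vanishing:
  fixes \<Psi> :: "complex \<Rightarrow> 'a::complex_normed_vector \<Rightarrow>\<^sub>L 'b::{complex_normed_vector, banach}"
  assumes \<alpha>: "0 < \<alpha>" "\<alpha> < 1" and \<beta>: "0 < \<beta>"
    and W: "lip_compact \<alpha> \<beta> (weighted_comp \<Psi> \<phi>)"
    and hol: "\<phi> holomorphic_on ball 0 1" and \<phi>: "\<And>z. norm z < 1 \<Longrightarrow> norm (\<phi> z) < 1"
    and \<Psi>: "\<Psi> \<in> disk_algebra bounded_ops"
  shows "vanishing_condition \<alpha> \<beta> \<phi> \<Psi>"
  unfolding vanishing_condition_iff
proof (intro allI impI)
  fix \<epsilon> :: real assume "0 < \<epsilon>"
  \<comment> \<open>The factor 20 is the 4 from Cauchy's estimate times the 5 from the test function.\<close>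
  then have \<epsilon>20: "0 < \<epsilon> / 20" by simp
  let ?T = "weighted_comp \<Psi> \<phi> ` {f \<in> lip_A UNIV \<alpha>. Lip_norm \<alpha> f \<le> 1}"
  have tb: "Metric_space.mtotally_bounded (lip_A UNIV \<beta>) (Lip_dist \<beta>) ?T"
    and sub: "weighted_comp \<Psi> \<phi> ` lip_A UNIV \<alpha> \<subseteq> lip_A UNIV \<beta>"
    using W by (simp_all add: lip_compact_iff_totally_bounded)
  obtain \<delta> where \<delta>: "0 < \<delta>" "\<And>f z w. f \<in> ?T \<Longrightarrow> z \<in> cball 0 1 \<Longrightarrow> w \<in> cball 0 1 \<Longrightarrow>
     norm (z - w) < \<delta> \<Longrightarrow> norm (f z - f w) \<le> \<epsilon> / 20 * norm (z - w) powr \<beta>"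
    by (rule uniformly_lipD[OF uniformly_lip_totally_bounded[OF tb] \<epsilon>20]) blast
  have "(1 - (norm (\<phi> z))\<^sup>2) powr (\<alpha> - 1) * norm (deriv \<phi> z) * norm (\<Psi> z)
          \<le> \<epsilon> * (1 - (norm z)\<^sup>2) powr (\<beta> - 1)"
    if z: "1 - \<delta> < norm z" "norm z < 1" for z
  proof -
    define k where "k = (1 - (norm (\<phi> z))\<^sup>2) powr (\<alpha> - 1) * norm (deriv \<phi> z)"
    have k: "0 \<le> k" by (simp add: k_def)
    have near: "(1 - (norm z)\<^sup>2) / 4 < \<delta>"
      using one_minus_norm_square_le[of z] z \<delta>(1) by linarith
    have "norm ((k / 5) *\<^sub>R \<Psi> z) \<le> 4 * (\<epsilon> / 20) * (1 - (norm z)\<^sup>2) powr (\<beta> - 1)"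
    proof (rule norm_blinfun_le_unit)
      fix x :: 'a assume x: "norm x \<le> 1"
      obtain f where f: "f \<in> lip_A UNIV \<alpha>" "Lip_norm \<alpha> f \<le> 1" "f (\<phi> z) = 0"
        "(f has_derivative (\<lambda>h. h *\<^sub>C ((1 - (norm (\<phi> z))\<^sup>2) powr (\<alpha> - 1) / 5) *\<^sub>R x)) (at (\<phi> z))"
        by (rule test_function[OF \<phi>[OF z(2)] \<alpha> x])
      let ?W = "weighted_comp \<Psi> \<phi> f"
      have WT: "?W \<in> ?T" using f by blast
      have "?W \<in> lip_A UNIV \<beta>" using sub f(1) by blast
      then have Wd: "?W \<in> disk_algebra UNIV" by (simp add: lip_A_def Lip_A_def)
      obtain T where T: "(\<Psi> has_derivative (\<lambda>h. h *\<^sub>C T)) (at z)"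
        using disk_algebra_derivative[OF \<Psi> z(2)] by blast
      have "(\<phi> has_field_derivative deriv \<phi> z) (at z)"
        by (rule holomorphic_derivI[OF hol open_ball]) (use z in simp)
      moreover have "\<Psi> z \<in> bounded_ops" using \<Psi> z by (auto simp: disk_algebra_def)
      ultimately have "(?W has_derivative (\<lambda>h. h *\<^sub>C (T (f (\<phi> z)) +
          deriv \<phi> z *\<^sub>C \<Psi> z (((1 - (norm (\<phi> z))\<^sup>2) powr (\<alpha> - 1) / 5) *\<^sub>R x)))) (at z)"
        using \<phi>[OF z(2)] by (intro weighted_comp_has_derivative z T f(4)) auto
      then have D: "(?W has_derivative (\<lambda>h. h *\<^sub>C
          (deriv \<phi> z *\<^sub>C ((1 - (norm (\<phi> z))\<^sup>2) powr (\<alpha> - 1) / 5) *\<^sub>R \<Psi> z x))) (at z)"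
        by (simp add: f(3) blinfun.zero_right blinfun.scaleR_right)
      have "norm (deriv \<phi> z *\<^sub>C ((1 - (norm (\<phi> z))\<^sup>2) powr (\<alpha> - 1) / 5) *\<^sub>R \<Psi> z x)
          \<le> 4 * (\<epsilon> / 20) * (1 - (norm z)\<^sup>2) powr (\<beta> - 1)"
      proof (rule derivative_le_powr[OF Wd z(2) D \<beta>])
        show "norm (?W u - ?W z) \<le> \<epsilon> / 20 * norm (u - z) powr \<beta>"
          if "u \<in> cball 0 1" "norm (u - z) = (1 - (norm z)\<^sup>2) / 4" for u
          using that z near by (intro \<delta>(2)[OF WT]) auto
      qed (use \<epsilon>20 in simp)
      also have "norm (deriv \<phi> z *\<^sub>C ((1 - (norm (\<phi> z))\<^sup>2) powr (\<alpha> - 1) / 5) *\<^sub>R \<Psi> z x) = norm (((k / 5) *\<^sub>R \<Psi> z) x)"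
        by (simp add: norm_scaleC k_def blinfun.scaleR_left abs_mult)
      finally show "norm (((k / 5) *\<^sub>R \<Psi> z) x) \<le> 4 * (\<epsilon> / 20) * (1 - (norm z)\<^sup>2) powr (\<beta> - 1)" .
    qed (use \<epsilon>20 in simp)
    then have "k * norm (\<Psi> z) \<le> \<epsilon> * (1 - (norm z)\<^sup>2) powr (\<beta> - 1)" using k by simp
    then show ?thesis unfolding k_def .
  qed
  then show "\<exists>s<1. \<forall>z. s < norm z \<and> norm z < 1 \<longrightarrow>
     (1 - (norm (\<phi> z))\<^sup>2) powr (\<alpha> - 1) * norm (deriv \<phi> z) * norm (\<Psi> z)
          \<le> \<epsilon> * (1 - (norm z)\<^sup>2) powr (\<beta> - 1)"
    using \<delta>(1) by (intro exI[of _ "1 - \<delta>"]) auto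
qed

text \<open>
  The product rule has two terms, each at most \<open>4 \<epsilon> (1 - |z|\<^sup>2) powr (\<beta> - 1)\<close>: the first by Cauchy's
  estimate for \<open>\<Psi>\<close>, the second by Cauchy's estimate for \<open>f\<close> at \<open>\<phi> z\<close> and the vanishing condition.
\<close>

lemma weighted_comp_derivative_le:
  fixes \<Psi> :: "complex \<Rightarrow> 'a::complex_normed_vector \<Rightarrow>\<^sub>L 'b::complex_normed_vector"
  assumes \<alpha>: "0 < \<alpha>" and \<beta>: "0 < \<beta>" and \<epsilon>: "0 < \<epsilon>"
    and hol: "\<phi> holomorphic_on ball 0 1" and \<phi>: "norm (\<phi> z) < 1"
    and \<Psi>: "\<Psi> \<in> disk_algebra bounded_ops" and z: "norm z < 1"
    and lip: "\<And>u. u \<in> cball 0 1 \<Longrightarrow> norm (u - z) = (1 - (norm z)\<^sup>2) / 4 \<Longrightarrow>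
       norm (\<Psi> u - \<Psi> z) \<le> \<epsilon> * norm (u - z) powr \<beta>"
    and van: "(1 - (norm (\<phi> z))\<^sup>2) powr (\<alpha> - 1) * norm (deriv \<phi> z) * norm (\<Psi> z)
          \<le> \<epsilon> * (1 - (norm z)\<^sup>2) powr (\<beta> - 1)"
    and f: "f \<in> Lip_A UNIV \<alpha>" "Lip_norm \<alpha> f \<le> 1"
  shows "\<exists>D. (weighted_comp \<Psi> \<phi> f has_derivative (\<lambda>h. h *\<^sub>C D)) (at z) \<and>
    norm D \<le> 8 * \<epsilon> * (1 - (norm z)\<^sup>2) powr (\<beta> - 1)"
proof -
  define p where "p = (1 - (norm z)\<^sup>2) powr (\<beta> - 1)"
  obtain T where T: "(\<Psi> has_derivative (\<lambda>h. h *\<^sub>C T)) (at z)"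
    using disk_algebra_derivative[OF \<Psi> z] by blast
  have fd: "f \<in> disk_algebra UNIV" using f(1) by (simp add: Lip_A_def)
  obtain d where d: "(f has_derivative (\<lambda>h. h *\<^sub>C d)) (at (\<phi> z))"
    using disk_algebra_derivative[OF fd \<phi>] by blast
  let ?D = "T (f (\<phi> z)) + deriv \<phi> z *\<^sub>C \<Psi> z d"
  have "(\<phi> has_field_derivative deriv \<phi> z) (at z)"
    by (rule holomorphic_derivI[OF hol open_ball]) (use z in simp)
  moreover have "\<Psi> z \<in> bounded_ops" using \<Psi> z by (auto simp: disk_algebra_def)
  ultimately have "(weighted_comp \<Psi> \<phi> f has_derivative (\<lambda>h. h *\<^sub>C ?D)) (at z)"
    using \<phi> by (intro weighted_comp_has_derivative z T d) auto
  moreover have "norm ?D \<le> 8 * \<epsilon> * p"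
  proof -
    have nT: "norm T \<le> 4 * \<epsilon> * p"
      unfolding p_def using \<epsilon> by (intro derivative_le_powr[OF \<Psi> z T \<beta>] lip) auto
    have nf: "norm (f (\<phi> z)) \<le> 1" using norm_le_Lip_norm[OF f(1), of "\<phi> z"] f(2) \<phi> by simp
    have nd: "norm d \<le> 4 * 1 * (1 - (norm (\<phi> z))\<^sup>2) powr (\<alpha> - 1)"
    proof (rule derivative_le_powr[OF fd \<phi> d \<alpha>])
      show "norm (f u - f (\<phi> z)) \<le> 1 * norm (u - \<phi> z) powr \<alpha>" if "u \<in> cball 0 1" for u
      proof -
        have "norm (f u - f (\<phi> z)) \<le> Lip_norm \<alpha> f * norm (u - \<phi> z) powr \<alpha>"
          using \<phi> by (intro Lip_A_le[OF f(1) that]) auto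
        also have "\<dots> \<le> 1 * norm (u - \<phi> z) powr \<alpha>" using f(2) by (intro mult_right_mono) auto
        finally show ?thesis .
      qed
    qed simp
    have "0 \<le> 4 * \<epsilon> * p" using \<epsilon> by (simp add: p_def)
    have "norm (T (f (\<phi> z))) \<le> norm T * norm (f (\<phi> z))" by (rule norm_blinfun)
    also have "\<dots> \<le> 4 * \<epsilon> * p * 1" using nT nf \<open>0 \<le> 4 * \<epsilon> * p\<close> by (intro mult_mono) auto
    finally have 1: "norm (T (f (\<phi> z))) \<le> 4 * \<epsilon> * p" by simp
    have "norm (deriv \<phi> z *\<^sub>C \<Psi> z d) \<le> norm (deriv \<phi> z) * (norm (\<Psi> z) * norm d)"
      unfolding norm_scaleC by (intro mult_left_mono norm_blinfun) auto
    also have "\<dots> \<le> norm (deriv \<phi> z) * (norm (\<Psi> z) * (4 * 1 * (1 - (norm (\<phi> z))\<^sup>2) powr (\<alpha> - 1)))"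
      by (intro mult_left_mono nd) auto
    also have "\<dots> = 4 * ((1 - (norm (\<phi> z))\<^sup>2) powr (\<alpha> - 1) * norm (deriv \<phi> z) * norm (\<Psi> z))" by simp
    also have "\<dots> \<le> 4 * (\<epsilon> * p)" using van by (intro mult_left_mono) (auto simp: p_def)
    finally have 2: "norm (deriv \<phi> z *\<^sub>C \<Psi> z d) \<le> 4 * (\<epsilon> * p)" .
    show ?thesis using norm_triangle_ineq[of "T (f (\<phi> z))" "deriv \<phi> z *\<^sub>C \<Psi> z d"] 1 2 by simp
  qed
  ultimately show ?thesis unfolding p_def by blast
qed

text \<open>
  Outside a disk of radius \<open>s\<close> the derivatives of the images are small multiples of
  \<open>(1 - |z|\<^sup>2) powr (\<beta> - 1)\<close>; inside they have a common bound \<open>C\<close>, as the images are uniformly bounded.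
  \<open>Hardy_Littlewood\<close> combines the two.
\<close>

lemma weighted_comp_uniformly_lip:
  fixes \<Psi> :: "complex \<Rightarrow> 'a::complex_normed_vector \<Rightarrow>\<^sub>L 'b::complex_normed_vector"
  assumes \<alpha>: "0 < \<alpha>" and \<beta>: "0 < \<beta>" "\<beta> \<le> 1"
    and sub: "weighted_comp \<Psi> \<phi> ` lip_A UNIV \<alpha> \<subseteq> lip_A UNIV \<beta>"
    and hol: "\<phi> holomorphic_on ball 0 1" and \<phi>: "\<And>z. norm z < 1 \<Longrightarrow> norm (\<phi> z) < 1"
    and \<phi>c: "\<phi> ` cball 0 1 \<subseteq> cball 0 1"
    and \<Psi>: "\<Psi> \<in> disk_algebra bounded_ops" "uniformly_lip \<beta> {\<Psi>}"
    and van: "vanishing_condition \<alpha> \<beta> \<phi> \<Psi>"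
  shows "uniformly_lip \<beta> (weighted_comp \<Psi> \<phi> ` {f \<in> lip_A UNIV \<alpha>. Lip_norm \<alpha> f \<le> 1})"
    (is "uniformly_lip \<beta> ?T")
proof (cases "\<beta> = 1")
  case True
  have eq: "g z = g w" if "g \<in> ?T" "z \<in> cball 0 1" "w \<in> cball 0 1" for g z w
    using lip_A_one_constant[of g UNIV z w] sub that True by auto
  show ?thesis
    unfolding uniformly_lip_def
  proof (intro allI impI exI[of _ 1] conjI ballI)
    fix \<epsilon> :: real and g and z w :: complex
    assume "0 < \<epsilon>" "g \<in> ?T" "z \<in> cball 0 1" "w \<in> cball 0 1"
    then show "norm (g z - g w) \<le> \<epsilon> * norm (z - w) powr \<beta>" using eq[of g z w] by simp
  qed simp
next
  case False
  then have \<beta>1: "\<beta> < 1" using \<beta> by simp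
  show ?thesis
    unfolding uniformly_lip_def
  proof (intro allI impI)
    fix \<epsilon> :: real assume \<epsilon>: "0 < \<epsilon>"
    have \<kappa>: "0 < 1 + 2 / \<beta>" using \<beta> by (simp add: add_pos_pos)
    \<comment> \<open>The bound 8 e for the derivative is multiplied by 1 + 2 / \<open>\<beta>\<close> on integration; this leaves \<open>\<epsilon> / 2\<close>.\<close>
    define e where "e = \<epsilon> / (16 * (1 + 2 / \<beta>))"
    have e: "0 < e" using \<epsilon> \<kappa> by (simp add: e_def)
    obtain \<delta>1 where \<delta>1: "0 < \<delta>1" "\<And>F z w. F \<in> {\<Psi>} \<Longrightarrow> z \<in> cball 0 1 \<Longrightarrow> w \<in> cball 0 1 \<Longrightarrow>
       norm (z - w) < \<delta>1 \<Longrightarrow> norm (F z - F w) \<le> e * norm (z - w) powr \<beta>"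
      by (rule uniformly_lipD[OF \<Psi>(2) e]) blast
    obtain s1 where s1: "s1 < 1" "\<forall>z. s1 < norm z \<and> norm z < 1 \<longrightarrow>
        (1 - (norm (\<phi> z))\<^sup>2) powr (\<alpha> - 1) * norm (deriv \<phi> z) * norm (\<Psi> z)
          \<le> e * (1 - (norm z)\<^sup>2) powr (\<beta> - 1)"
      using van e unfolding vanishing_condition_iff by blast
    define s where "s = max 0 (max s1 (1 - \<delta>1))"
    have s: "0 \<le> s" "s < 1" "s1 \<le> s" "1 - \<delta>1 \<le> s" using s1(1) \<delta>1(1) by (auto simp: s_def)
    have s2: "0 < 1 - s\<^sup>2" using s by (simp add: power_less_one_iff abs_square_less_1)
    define P where "P = (SUP z\<in>cball 0 1. norm (\<Psi> z))"
    have P: "norm (\<Psi> z) \<le> P" if "z \<in> cball 0 1" for z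
      unfolding P_def by (rule cSUP_upper[OF that disk_algebra_bdd[OF \<Psi>(1)]])
    have P0: "0 \<le> P" using order_trans[OF norm_ge_zero P[of 0]] by simp
    define C where "C = P / ((1 - s\<^sup>2) / 4)"
    have C: "0 \<le> C" using P0 s2 by (simp add: C_def)
    have der: "\<exists>D. (g has_derivative (\<lambda>h. h *\<^sub>C D)) (at z) \<and>
        norm D \<le> 8 * e * (1 - (norm z)\<^sup>2) powr (\<beta> - 1) + C"
      if g: "g \<in> ?T" and z: "norm z < 1" for g z
    proof -
      obtain f where f: "f \<in> lip_A UNIV \<alpha>" "Lip_norm \<alpha> f \<le> 1" "g = weighted_comp \<Psi> \<phi> f"
        using g by blast
      have fL: "f \<in> Lip_A UNIV \<alpha>" using f(1) by (simp add: lip_A_def)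
      show ?thesis
      proof (cases "s < norm z")
        case True
        have near: "(1 - (norm z)\<^sup>2) / 4 < \<delta>1"
          using one_minus_norm_square_le[of z] z s \<delta>1(1) True by linarith
        have "\<exists>D. (weighted_comp \<Psi> \<phi> f has_derivative (\<lambda>h. h *\<^sub>C D)) (at z) \<and>
            norm D \<le> 8 * e * (1 - (norm z)\<^sup>2) powr (\<beta> - 1)"
        proof (rule weighted_comp_derivative_le[OF \<alpha> \<beta>(1) e hol \<phi>[OF z] \<Psi>(1) z _ _ fL f(2)])
          show "norm (\<Psi> u - \<Psi> z) \<le> e * norm (u - z) powr \<beta>"
            if "u \<in> cball 0 1" "norm (u - z) = (1 - (norm z)\<^sup>2) / 4" for u
            using that near z by (intro \<delta>1(2)) auto
          show "(1 - (norm (\<phi> z))\<^sup>2) powr (\<alpha> - 1) * norm (deriv \<phi> z) * norm (\<Psi> z)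
              \<le> e * (1 - (norm z)\<^sup>2) powr (\<beta> - 1)"
            using s1(2) s True z by auto
        qed
        then show ?thesis unfolding f(3) using C by (meson add_increasing2)
      next
        case False
        have "g \<in> lip_A UNIV \<beta>" using sub f by blast
        then have gd: "g \<in> disk_algebra UNIV" by (simp add: lip_A_def Lip_A_def)
        obtain D where D: "(g has_derivative (\<lambda>h. h *\<^sub>C D)) (at z)"
          using disk_algebra_derivative[OF gd z] by blast
        note b = ball_subset_unit_ball[OF z]
        have le: "(norm z)\<^sup>2 \<le> s\<^sup>2" using False by (intro power_mono) auto
        have "norm D \<le> P / ((1 - (norm z)\<^sup>2) / 4)"
        proof (rule Cauchy_estimate[where F = g and c = 0 and z = z and R = "(1 - (norm z)\<^sup>2) / 2"])
          show "\<exists>d. (g has_derivative (\<lambda>h. h *\<^sub>C d)) (at u)" if "u \<in> ball z ((1 - (norm z)\<^sup>2) / 2)" for u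
          proof -
            have "norm u < 1" using b(1) that by auto
            then show ?thesis using disk_algebra_derivative[OF gd] by blast
          qed
          show "norm (g u - 0) \<le> P" if "dist z u = (1 - (norm z)\<^sup>2) / 4" for u
          proof -
            have "u \<in> ball z ((1 - (norm z)\<^sup>2) / 2)" using that b(2) by simp
            then have u: "u \<in> cball 0 1" using b(1) by auto
            then have "\<phi> u \<in> cball 0 1" using \<phi>c by blast
            then have "norm (f (\<phi> u)) \<le> 1" using norm_le_Lip_norm[OF fL] f(2) by force
            have "norm (g u) \<le> norm (\<Psi> u) * norm (f (\<phi> u))"
              unfolding f(3) using u norm_blinfun[of "\<Psi> u"] by (simp add: weighted_comp_def)
            also have "\<dots> \<le> P * 1" using P[OF u] P0 \<open>norm (f (\<phi> u)) \<le> 1\<close> by (intro mult_mono) auto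
            finally show ?thesis by simp
          qed
        qed (use b(2) D in auto)
        also have "\<dots> \<le> C"
          unfolding C_def using P0 s2 le b(2) by (intro divide_left_mono mult_pos_pos) auto
        finally have "norm D \<le> 8 * e * (1 - (norm z)\<^sup>2) powr (\<beta> - 1) + C"
          using e by (simp add: add_increasing)
        with D show ?thesis by blast
      qed
    qed
    have \<epsilon>2: "0 < \<epsilon> / 2" and C3: "0 \<le> 3 * C" using \<epsilon> C by auto
    obtain \<delta>2 where \<delta>2: "0 < \<delta>2" "\<forall>t. 0 \<le> t \<and> t < \<delta>2 \<longrightarrow> 3 * C * t \<le> \<epsilon> / 2 * t powr \<beta>"
      using linear_le_powr[OF C3 \<beta>1 \<epsilon>2] by blast
    have "norm (g z - g w) \<le> \<epsilon> * norm (z - w) powr \<beta>"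
      if g: "g \<in> ?T" and zw: "z \<in> cball 0 1" "w \<in> cball 0 1" "norm (z - w) < min 1 \<delta>2" for g z w
    proof -
      have "g \<in> lip_A UNIV \<beta>" using sub g by blast
      then have "continuous_on (cball 0 1) g" by (simp add: lip_A_def Lip_A_def disk_algebra_def)
      then have "norm (g z - g w) \<le> (1 + 2 / \<beta>) * (8 * e) * norm (z - w) powr \<beta> + 3 * C * norm (z - w)"
        using e zw by (intro Hardy_Littlewood[OF \<beta> _ C _ der[OF g]]) auto
      moreover have "(1 + 2 / \<beta>) * (8 * e) = \<epsilon> / 2" using \<kappa> by (simp add: e_def field_simps)
      moreover have "3 * C * norm (z - w) \<le> \<epsilon> / 2 * norm (z - w) powr \<beta>" using \<delta>2(2) zw(3) by simp
      ultimately show ?thesis by simp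
    qed
    then show "\<exists>\<delta>>0. \<forall>f\<in>?T. \<forall>z\<in>cball 0 1. \<forall>w\<in>cball 0 1.
       norm (z - w) < \<delta> \<longrightarrow> norm (f z - f w) \<le> \<epsilon> * norm (z - w) powr \<beta>"
      using \<delta>2(1) by (intro exI[of _ "min 1 \<delta>2"] conjI) (simp, blast)
  qed
qed

theorem corollary3p4:
  fixes \<phi> :: "complex \<Rightarrow> complex"
    and \<Psi> :: "complex \<Rightarrow> 'a::{complex_normed_vector, banach} \<Rightarrow>\<^sub>L 'b::{complex_normed_vector, banach}"
    and \<alpha> \<beta> :: real
  assumes "0 < \<alpha>" "\<alpha> \<le> 1" "0 < \<beta>" "\<beta> \<le> 1"
    and "continuous_on (cball 0 1) \<phi>" "\<phi> holomorphic_on ball 0 1"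
    and "\<phi> ` cball 0 1 \<subseteq> cball 0 1" "\<not> \<phi> constant_on cball 0 1"
    and "\<Psi> \<in> disk_algebra bounded_ops"
    and "lip_bounded \<alpha> \<beta> (weighted_comp \<Psi> \<phi>)"
  shows "(lip_compact \<alpha> \<beta> (weighted_comp \<Psi> \<phi>) \<longrightarrow>
            \<Psi> \<in> Lip_A compact_ops \<beta> \<and> (\<alpha> < 1 \<longrightarrow> vanishing_condition \<alpha> \<beta> \<phi> \<Psi>)) \<and>
         (\<Psi> \<in> lip_A compact_ops \<beta> \<and> vanishing_condition \<alpha> \<beta> \<phi> \<Psi> \<longrightarrow>
            lip_compact \<alpha> \<beta> (weighted_comp \<Psi> \<phi>))"
proof -
  have \<phi>: "norm (\<phi> z) < 1" if "norm z < 1" for z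
    by (rule nonconstant_self_map[OF assms(5-8) that])
  have sub: "weighted_comp \<Psi> \<phi> ` lip_A UNIV \<alpha> \<subseteq> lip_A UNIV \<beta>"
    using assms(10) by (simp add: lip_bounded_def)
  show ?thesis
  proof (intro conjI impI)
    assume W: "lip_compact \<alpha> \<beta> (weighted_comp \<Psi> \<phi>)"
    show "\<Psi> \<in> Lip_A compact_ops \<beta>"
      using lip_compact_symbol[OF W assms(7,9)] lip_bounded_symbol[OF assms(10,7)]
      by (simp add: Lip_A_def)
    show "vanishing_condition \<alpha> \<beta> \<phi> \<Psi>" if "\<alpha> < 1"
      by (rule lip_compact_vanishing[OF assms(1) that assms(3) W assms(6) \<phi> assms(9)])
  next
    assume *: "\<Psi> \<in> lip_A compact_ops \<beta> \<and> vanishing_condition \<alpha> \<beta> \<phi> \<Psi>"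
    let ?B = "{f \<in> lip_A UNIV \<alpha>. Lip_norm \<alpha> f \<le> 1} :: (complex \<Rightarrow> 'a) set"
    have u: "uniformly_lip \<beta> (weighted_comp \<Psi> \<phi> ` ?B)"
      using * by (intro weighted_comp_uniformly_lip assms sub \<phi>) (auto simp: lip_A_iff)
    have "Metric_space.mtotally_bounded (lip_A UNIV \<beta>) (Lip_dist \<beta>) (weighted_comp \<Psi> \<phi> ` ?B)"
    proof (rule totally_bounded_uniformly_lip[OF assms(3) _ u])
      show "weighted_comp \<Psi> \<phi> ` ?B \<subseteq> lip_A UNIV \<beta>" using sub by blast
      fix z :: complex and \<epsilon> :: real assume z: "z \<in> cball 0 1" and \<epsilon>: "0 < \<epsilon>"
      have "(\<lambda>g. g z) ` weighted_comp \<Psi> \<phi> ` ?B \<subseteq> blinfun_apply (\<Psi> z) ` cball 0 1"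
      proof clarify
        fix f :: "complex \<Rightarrow> 'a" assume f: "f \<in> lip_A UNIV \<alpha>" "Lip_norm \<alpha> f \<le> 1"
        then have fL: "f \<in> Lip_A UNIV \<alpha>" by (simp add: lip_A_def)
        have "\<phi> z \<in> cball 0 1" using z assms(7) by blast
        then have "norm (f (\<phi> z)) \<le> 1" using norm_le_Lip_norm[OF fL] f(2) by force
        then show "weighted_comp \<Psi> \<phi> f z \<in> blinfun_apply (\<Psi> z) ` cball 0 1"
          using z by (simp add: weighted_comp_def)
      qed
      moreover have "\<Psi> z \<in> compact_ops"
        using * z by (auto simp: lip_A_iff Lip_A_def disk_algebra_def)
      then obtain k where "finite k" "blinfun_apply (\<Psi> z) ` cball 0 1 \<subseteq> (\<Union>y\<in>k. ball y \<epsilon>)"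
        using \<epsilon> unfolding compact_ops_def compact_closure_iff_totally_bounded by blast
      ultimately show "\<exists>k. finite k \<and> (\<lambda>g. g z) ` weighted_comp \<Psi> \<phi> ` ?B \<subseteq> (\<Union>y\<in>k. ball y \<epsilon>)"
        by (meson order_trans)
    qed
    then show "lip_compact \<alpha> \<beta> (weighted_comp \<Psi> \<phi>)"
      using sub by (simp add: lip_compact_iff_totally_bounded)
  qed
qed

end
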